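(* Let $M\ge2$, let $J$ be an irreducible symmetric tridiagonal (Jacobi) real matrix on $\mathbb{C}^M$, with nonzero off-diagonal entries and hence simple spectrum $\mu_0,\ldots,\mu_{M-1}$, and let $R=f(J)$ for a real-valued $f$ injective on $\{\mu_k\}$. Then $R$ is self-adjoint with simple spectrum and $[R,J]=0$, and the double-commutator pencil $\mathrm{ad}_R^2(A)=\lambda A$ over the symmetric tridiagonal matrices $\mathcal{T}$ has kernel exactly $\operatorname{span}\{\mathbf{I},J\}$, so its eigenvalues obey $0=\lambda_1=\lambda_2<\lambda_3$. The nontrivial null vector is $J$ up to affine normalization (every kernel element independent of $\mathbf I$ is $\alpha J+\beta\mathbf I$ with $\alpha\neq0$), and its eigenbasis is the orthogonal-polynomial transform generated by $J$, with columns $(v_k)_i=\sqrt{w_k}\,p_i(\mu_k)$, $0\le i,k\le M-1$, given by the orthonormal polynomials $p_i$ of the spectral measure $\nu=\sum_k w_k\delta_{\mu_k}$; this is the unique Karhunen–Loève transform of $R$.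
   Context: $[X,Y]=XY-YX$, $\mathrm{ad}_R^2(A)=[R,[R,A]]$. $\mathcal{T}$ is the $(2M-1)$-dimensional real space of real symmetric tridiagonal $M\times M$ matrices. The pencil over $\mathcal{T}$ with basis $B_1,\dots,B_d$ ($d=2M-1$) is $\mathbf{M}\mathbf{c}=\lambda\mathbf{G}\mathbf{c}$ with $\mathbf{M}_{ij}=\operatorname{Tr}(B_i^H\mathrm{ad}_R^2(B_j))$, $\mathbf{G}_{ij}=\operatorname{Tr}(B_i^HB_j)$, and eigenvalues $\lambda_1\le\lambda_2\le\cdots\le\lambda_d$; an element $A=\sum_jc_jB_j$ is in the kernel if $\mathbf{M}\mathbf{c}=0$. The weights are $w_k=(v_k)_0^2$, where $v_k$ is the unit real eigenvector of $J$ for $\mu_k$, with rows indexed from $0$. The $p_i$ ($\deg p_i=i$) satisfy $\sum_kw_kp_i(\mu_k)p_j(\mu_k)=\delta_{ij}$ (with signs of leading coefficients and of the $v_k$ chosen compatibly with the off-diagonal entries of $J$). The Karhunen–Loève transform of $R$ is its orthonormal eigenbasis; uniqueness is up to ordering and unit scalars. *)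

theory Defs
  imports
    "Jordan_Normal_Form.Spectral_Radius"
    "Jordan_Normal_Form.Schur_Decomposition"
    "HOL-Combinatorics.Permutations"
begin

definition commutator :: "complex mat \<Rightarrow> complex mat \<Rightarrow> complex mat" where
  "commutator X Y = X * Y - Y * X"

definition ad2 :: "complex mat \<Rightarrow> complex mat \<Rightarrow> complex mat" where
  "ad2 R A = commutator R (commutator R A)"

definition mat_trace :: "complex mat \<Rightarrow> complex" where
  "mat_trace A = (\<Sum>i<dim_row A. A $$ (i, i))"

text \<open>Real matrices are complex matrices with real entries; the set below is regarded as a
  vector space over the reals.\<close>

definition sym_tridiagonal :: "nat \<Rightarrow> complex mat set" where
  "sym_tridiagonal M = {A \<in> carrier_mat M M.
     elements_mat A \<subseteq> \<real> \<and> transpose_mat A = A \<and>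
     (\<forall>i<M. \<forall>j<M. i + 1 < j \<or> j + 1 < i \<longrightarrow> A $$ (i, j) = 0)}"

definition jacobi_matrix :: "nat \<Rightarrow> complex mat \<Rightarrow> bool" where
  "jacobi_matrix M J \<longleftrightarrow> J \<in> sym_tridiagonal M \<and> (\<forall>i. i + 1 < M \<longrightarrow> J $$ (i, i + 1) \<noteq> 0)"

text \<open>Every eigenvalue has algebraic multiplicity one.\<close>

definition simple_spectrum :: "complex mat \<Rightarrow> bool" where
  "simple_spectrum A \<longleftrightarrow> (\<forall>z\<in>spectrum A. order z (char_poly A) = 1)"

definition unitary_mat :: "nat \<Rightarrow> complex mat \<Rightarrow> bool" where
  "unitary_mat M U \<longleftrightarrow> U \<in> carrier_mat M M \<and> mat_adjoint U * U = 1\<^sub>m M"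

text \<open>Functional calculus for a self-adjoint matrix: if \<open>A = U diag(d) U\<^sup>H\<close> with \<open>U\<close> unitary
  and \<open>d\<close> real, then \<open>f(A) = U diag(f \<circ> d) U\<^sup>H\<close>. The result does not depend on the chosen
  diagonalization, and it is unspecified if \<open>A\<close> is not self-adjoint.\<close>

definition mat_fun :: "nat \<Rightarrow> (real \<Rightarrow> real) \<Rightarrow> complex mat \<Rightarrow> complex mat" where
  "mat_fun M f A = (THE B. \<exists>U d. unitary_mat M U \<and>
     A = U * mat_diag M (\<lambda>k. complex_of_real (d k)) * mat_adjoint U \<and>
     B = U * mat_diag M (\<lambda>k. complex_of_real (f (d k))) * mat_adjoint U)"

definition real_lincomb :: "nat \<Rightarrow> real vec \<Rightarrow> complex mat list \<Rightarrow> complex mat" where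
  "real_lincomb M c Bs =
     mat M M (\<lambda>(r, s). \<Sum>j<length Bs. complex_of_real (c $ j) * (Bs ! j) $$ (r, s))"

definition real_span :: "nat \<Rightarrow> complex mat list \<Rightarrow> complex mat set" where
  "real_span M Bs = {real_lincomb M c Bs | c. c \<in> carrier_vec (length Bs)}"

definition real_lin_indpt :: "nat \<Rightarrow> complex mat list \<Rightarrow> bool" where
  "real_lin_indpt M Bs \<longleftrightarrow>
     (\<forall>c \<in> carrier_vec (length Bs). real_lincomb M c Bs = 0\<^sub>m M M \<longrightarrow> c = 0\<^sub>v (length Bs))"

definition sym_tridiagonal_basis :: "nat \<Rightarrow> complex mat list \<Rightarrow> bool" where
  "sym_tridiagonal_basis M Bs \<longleftrightarrow> length Bs = 2 * M - 1 \<and>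
     set Bs \<subseteq> sym_tridiagonal M \<and> real_lin_indpt M Bs \<and> real_span M Bs = sym_tridiagonal M"

definition pencil_M :: "complex mat \<Rightarrow> complex mat list \<Rightarrow> complex mat" where
  "pencil_M R Bs = mat (length Bs) (length Bs)
     (\<lambda>(i, j). mat_trace (mat_adjoint (Bs ! i) * ad2 R (Bs ! j)))"

definition pencil_G :: "complex mat list \<Rightarrow> complex mat" where
  "pencil_G Bs = mat (length Bs) (length Bs)
     (\<lambda>(i, j). mat_trace (mat_adjoint (Bs ! i) * (Bs ! j)))"

definition pencil_kernel :: "nat \<Rightarrow> complex mat \<Rightarrow> complex mat list \<Rightarrow> complex mat set" where
  "pencil_kernel M R Bs = {real_lincomb M c Bs | c. c \<in> carrier_vec (length Bs) \<and>
     pencil_M R Bs *\<^sub>v map_vec complex_of_real c = 0\<^sub>v (length Bs)}"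

text \<open>The characteristic polynomial \<open>det (K - x G)\<close> of the generalized eigenvalue problem
  \<open>K c = x G c\<close>.\<close>

definition pencil_char_poly :: "complex mat \<Rightarrow> complex mat \<Rightarrow> complex poly" where
  "pencil_char_poly K G =
     det (map_mat (\<lambda>a. [:a:]) K - [:0, 1:] \<cdot>\<^sub>m map_mat (\<lambda>a. [:a:]) G)"

text \<open>\<open>ls\<close> is the nondecreasing list of all eigenvalues of the pencil, repeated according to
  multiplicity; the pencil has only real eigenvalues, and as many as its dimension.\<close>

definition pencil_eigenvalues :: "complex mat \<Rightarrow> complex mat \<Rightarrow> real list \<Rightarrow> bool" where
  "pencil_eigenvalues K G ls \<longleftrightarrow> sorted ls \<and> length ls = dim_row K \<and>
     (\<exists>a. a \<noteq> 0 \<and>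
        pencil_char_poly K G = Polynomial.smult a (\<Prod>l\<leftarrow>ls. [:- complex_of_real l, 1:]))"

definition unit_real_eigenvector :: "complex mat \<Rightarrow> real \<Rightarrow> complex vec \<Rightarrow> bool" where
  "unit_real_eigenvector A x v \<longleftrightarrow> eigenvector A v (complex_of_real x) \<and>
     (\<forall>i<dim_vec v. v $ i \<in> \<real>) \<and> v \<bullet>c v = 1"

definition orthonormal_polys ::
  "nat \<Rightarrow> (nat \<Rightarrow> real) \<Rightarrow> (nat \<Rightarrow> real) \<Rightarrow> (nat \<Rightarrow> real poly) \<Rightarrow> bool" where
  "orthonormal_polys M \<mu> w p \<longleftrightarrow> (\<forall>i<M. degree (p i) = i) \<and>
     (\<forall>i<M. \<forall>j<M. (\<Sum>k<M. w k * poly (p i) (\<mu> k) * poly (p j) (\<mu> k)) = (if i = j then 1 else 0))"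

text \<open>The sign conventions. With \<open>b\<^sub>i = J\<^sub>i\<^sub>,\<^sub>i\<^sub>+\<^sub>1\<close> the three-term recurrence
  \<open>x p\<^sub>i = b\<^sub>i\<^sub>-\<^sub>1 p\<^sub>i\<^sub>-\<^sub>1 + a\<^sub>i p\<^sub>i + b\<^sub>i p\<^sub>i\<^sub>+\<^sub>1\<close> forces
  \<open>lc p\<^sub>i = b\<^sub>i lc p\<^sub>i\<^sub>+\<^sub>1\<close>; the sign of each \<open>v\<^sub>k\<close> is fixed through its entry \<open>0\<close>,
  which is to have the sign of the constant \<open>p\<^sub>0\<close>.\<close>

definition compatible_signs ::
  "nat \<Rightarrow> complex mat \<Rightarrow> (nat \<Rightarrow> complex vec) \<Rightarrow> (nat \<Rightarrow> real poly) \<Rightarrow> bool" where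
  "compatible_signs M J v p \<longleftrightarrow>
     (\<forall>i. i + 1 < M \<longrightarrow>
        sgn (lead_coeff (p (i + 1))) = sgn (lead_coeff (p i)) * sgn (Re (J $$ (i, i + 1)))) \<and>
     (\<forall>k<M. sgn (Re (v k $ 0)) = sgn (lead_coeff (p 0)))"

definition spectral_weight :: "(nat \<Rightarrow> complex vec) \<Rightarrow> nat \<Rightarrow> real" where
  "spectral_weight v k = (Re (v k $ 0))\<^sup>2"

definition op_transform ::
  "nat \<Rightarrow> (nat \<Rightarrow> real) \<Rightarrow> (nat \<Rightarrow> real) \<Rightarrow> (nat \<Rightarrow> real poly) \<Rightarrow> complex mat" where
  "op_transform M \<mu> w p =
     mat M M (\<lambda>(i, k). complex_of_real (sqrt (w k) * poly (p i) (\<mu> k)))"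

text \<open>The basis vectors are the columns of \<open>U\<close>.\<close>

definition orthonormal_eigenbasis :: "nat \<Rightarrow> complex mat \<Rightarrow> complex mat \<Rightarrow> bool" where
  "orthonormal_eigenbasis M A U \<longleftrightarrow>
     unitary_mat M U \<and> (\<forall>k<M. \<exists>z. eigenvector A (col U k) z)"

definition same_up_to_order_and_phase :: "nat \<Rightarrow> complex mat \<Rightarrow> complex mat \<Rightarrow> bool" where
  "same_up_to_order_and_phase M U V \<longleftrightarrow>
     (\<exists>\<pi> c. \<pi> permutes {..<M} \<and>
        (\<forall>k<M. cmod (c k) = 1 \<and> col U k = c k \<cdot>\<^sub>v col V (\<pi> k)))"

definition unique_orthonormal_eigenbasis :: "nat \<Rightarrow> complex mat \<Rightarrow> complex mat \<Rightarrow> bool" where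
  "unique_orthonormal_eigenbasis M A V \<longleftrightarrow> orthonormal_eigenbasis M A V \<and>
     (\<forall>U. orthonormal_eigenbasis M A U \<longrightarrow> same_up_to_order_and_phase M U V)"

text \<open>The Karhunen--Loeve transform of a self-adjoint \<open>R\<close> is its orthonormal eigenbasis.\<close>

definition unique_karhunen_loeve :: "nat \<Rightarrow> complex mat \<Rightarrow> complex mat \<Rightarrow> bool" where
  "unique_karhunen_loeve M R V \<longleftrightarrow> unique_orthonormal_eigenbasis M R V"

end

theory Submission
  imports Defs
begin

text \<open>Since \<open>e\<^sub>0\<close> is a cyclic vector of \<open>J\<close>, an eigenvector \<open>v\<close> of \<open>J\<close> for \<open>x\<close> is determined by its
  entry \<open>v\<^sub>0\<close> through \<open>v\<^sub>i = v\<^sub>0 q\<^sub>i(x)\<close>, where the polynomials \<open>q\<^sub>i\<close> solve the three-term recurrence of \<open>J\<close>;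
  hence the spectrum is simple, and orthonormality of the rows of the eigenvector matrix says that
  the \<open>q\<^sub>i\<close> are orthonormal for the spectral measure. Orthonormal polynomials are unique up to sign.

  In the trace inner product \<open>ad\<^sub>R\<^sup>2\<close> has the quadratic form \<open>A \<mapsto> |[R, A]|\<^sup>2\<close>, so the pencil is a pair of
  Gram matrices that can be diagonalized simultaneously, with nonnegative eigenvalues, and
  its kernel consists of the tridiagonal matrices commuting with \<open>R\<close>. As \<open>f\<close> separates the
  spectrum, these commute with \<open>J\<close>; subtracting the combination of \<open>J\<close> and the identity that has the
  same first column leaves a matrix that commutes with \<open>J\<close> and kills \<open>e\<^sub>0\<close>, hence is zero.\<close>

section \<open>Unitary diagonalization and functional calculus\<close>

text \<open>\<open>mat_fun\<close> is a definite description over all unitary diagonalizations, so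
  nothing can be said about \<open>R\<close> until independence of the choice is known. One
  intertwining principle settles this, gives \<open>R * J = J * R\<close>, and leads back from
  matrices commuting with \<open>R\<close> to matrices commuting with \<open>J\<close>: in
  eigenbases, an intertwiner couples only equal eigenvalues. The pencil is posed over a real basis,
  but its characteristic polynomial and the diagonalizing congruence live over the complex numbers.
  The multiplicity of the eigenvalue zero is therefore found by counting orthonormal complex
  combinations of basis matrices that commute with \<open>R\<close>. This is why the real basis has
  to be independent over the complex numbers too, and why the commutant argument admits complex
  matrices. The system \<open>(v, p)\<close> is arbitrary within the sign conventions, while the
  recurrence polynomials start with the constant 1. The conventions leave one common sign, which
  occurs in both factors of \<open>sqrt (w k) * poly (p i) (\<mu> k)\<close> and cancels.\<close>

lemma mat_adjoint_dim [simp]: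
  "dim_row (mat_adjoint A) = dim_col A" "dim_col (mat_adjoint A) = dim_row A"
  by (auto simp: mat_adjoint_def)

lemma mat_adjoint_carrier [simp]: "A \<in> carrier_mat n m \<Longrightarrow> mat_adjoint A \<in> carrier_mat m n"
  by (intro carrier_matI) auto

lemma mat_adjoint_index [simp]:
  fixes A :: "complex mat"
  shows "i < dim_col A \<Longrightarrow> j < dim_row A \<Longrightarrow> mat_adjoint A $$ (i, j) = cnj (A $$ (j, i))"
  by (simp add: mat_adjoint_def mat_of_rows_index)

text \<open>Entries as explicit sums instead of scalar products of rows and columns; the simp rule
  \<open>index_mult_mat(1)\<close> is switched off wherever this form has to apply.\<close>

lemma mat_mult_index:
  assumes "A \<in> carrier_mat n m" "B \<in> carrier_mat m k" "i < n" "j < k"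
  shows "(A * B) $$ (i, j) = (\<Sum>l<m. A $$ (i, l) * B $$ (l, j))"
  using assms by (auto simp: scalar_prod_def atLeast0LessThan intro!: sum.cong)

lemma mat_mult_vec_index:
  assumes "A \<in> carrier_mat n m" "v \<in> carrier_vec m" "i < n"
  shows "(A *\<^sub>v v) $ i = (\<Sum>l<m. A $$ (i, l) * v $ l)"
  using assms by (auto simp: scalar_prod_def atLeast0LessThan intro!: sum.cong)

lemma mat_adjoint_mult:
  fixes A B :: "complex mat"
  assumes "A \<in> carrier_mat n m" "B \<in> carrier_mat m k"
  shows "mat_adjoint (A * B) = mat_adjoint B * mat_adjoint A"
proof (rule eq_matI)
  fix i j assume "i < dim_row (mat_adjoint B * mat_adjoint A)"
    "j < dim_col (mat_adjoint B * mat_adjoint A)"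
  with assms have ij: "i < k" "j < n" by auto
  with assms show "mat_adjoint (A * B) $$ (i, j) = (mat_adjoint B * mat_adjoint A) $$ (i, j)"
    by (simp add: mat_mult_index[OF assms] mat_mult_index[of _ k m _ n] cnj_sum mult.commute
        del: index_mult_mat(1))
qed (use assms in auto)

lemma mat_adjoint_adjoint [simp]: "mat_adjoint (mat_adjoint (A :: complex mat)) = A"
  by (rule eq_matI) auto

lemma mat_diag_dims [simp]: "dim_row (mat_diag n g) = n" "dim_col (mat_diag n g) = n"
  by (auto simp: mat_diag_def)

lemma mat_diag_index [simp]:
  "i < n \<Longrightarrow> j < n \<Longrightarrow> mat_diag n g $$ (i, j) = (if i = j then g j else 0)"
  by (auto simp: mat_diag_def)

lemma mat_adjoint_diag [simp]: "mat_adjoint (mat_diag n g) = mat_diag n (\<lambda>i. cnj (g i))"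
  by (rule eq_matI) auto

lemma unitary_matD:
  assumes "unitary_mat n U"
  shows "U \<in> carrier_mat n n" "mat_adjoint U \<in> carrier_mat n n"
    "mat_adjoint U * U = 1\<^sub>m n" "U * mat_adjoint U = 1\<^sub>m n"
proof -
  show U: "U \<in> carrier_mat n n" and UU: "mat_adjoint U * U = 1\<^sub>m n"
    using assms by (auto simp: unitary_mat_def)
  then show Ua: "mat_adjoint U \<in> carrier_mat n n" by simp
  show "U * mat_adjoint U = 1\<^sub>m n" by (rule mat_mult_left_right_inverse[OF Ua U UU])
qed

lemma unitary_mat_mult:
  assumes "unitary_mat n U" "unitary_mat n V"
  shows "unitary_mat n (U * V)"
proof -
  note U = unitary_matD[OF assms(1)] and V = unitary_matD[OF assms(2)]
  have "mat_adjoint (U * V) * (U * V) = mat_adjoint V * (mat_adjoint U * U) * V"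
    using U(1,2) V(1,2) by (simp add: mat_adjoint_mult[of _ n n _ n] assoc_mult_mat[of _ n n _ n _ n]
        mult_carrier_mat[of _ n n])
  then show ?thesis using U V by (simp add: unitary_mat_def)
qed

text \<open>Long products are normalized by associating to the right, where an inverse pair stands
  in this nested position.\<close>

lemma cancel_left_mat:
  fixes U V X :: "'a :: semiring_1 mat"
  assumes "U \<in> carrier_mat n n" "V \<in> carrier_mat n n" "U * V = 1\<^sub>m n" "X \<in> carrier_mat n m"
  shows "U * (V * X) = X"
  using assoc_mult_mat[OF assms(1,2,4)] left_mult_one_mat[OF assms(4)] assms(3) by simp

text \<open>The relation over which \<open>mat_fun\<close> quantifies, with its witnesses exposed,
  so that one \<open>U\<close> can be shared by \<open>J\<close> and every function of
  \<open>J\<close>.\<close>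

definition unitary_diag :: "nat \<Rightarrow> complex mat \<Rightarrow> complex mat \<Rightarrow> (nat \<Rightarrow> real) \<Rightarrow> bool" where
  "unitary_diag n A U d \<longleftrightarrow> unitary_mat n U \<and>
     A = U * mat_diag n (\<lambda>k. complex_of_real (d k)) * mat_adjoint U"

lemma unitary_diag_carrier: "unitary_diag n A U d \<Longrightarrow> A \<in> carrier_mat n n"
  using unitary_matD[of n U] by (auto simp: unitary_diag_def intro!: mult_carrier_mat[of _ n n])

lemma unitary_diag_hermitian:
  assumes "unitary_diag n A U d" shows "mat_adjoint A = A"
proof -
  have U: "unitary_mat n U" and A: "A = U * mat_diag n (\<lambda>k. complex_of_real (d k)) * mat_adjoint U"
    using assms by (auto simp: unitary_diag_def)
  note U = unitary_matD[OF U]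
  show ?thesis unfolding A using U(1,2)
    by (simp add: mat_adjoint_mult[of _ n n _ n] assoc_mult_mat[of _ n n _ n _ n] mult_carrier_mat[of _ n n])
qed

lemma unitary_diag_iff:
  assumes U: "unitary_mat n U" and A: "A \<in> carrier_mat n n"
  shows "unitary_diag n A U d \<longleftrightarrow> A * U = U * mat_diag n (\<lambda>k. complex_of_real (d k))"
proof -
  note [simp] = assoc_mult_mat[of _ n n _ n _ n] mult_carrier_mat[of _ n n]
  note U' = unitary_matD[OF U]
  let ?D = "mat_diag n (\<lambda>k. complex_of_real (d k))"
  have "A * U = U * ?D" if "A = U * ?D * mat_adjoint U"
    unfolding that using U' by simp
  moreover have "A = U * ?D * mat_adjoint U" if "A * U = U * ?D"
    using U' A by (simp flip: that)
  ultimately show ?thesis using U unfolding unitary_diag_def by blast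
qed

lemma unitary_diag_iff_index:
  assumes U: "unitary_mat n U" and A: "A \<in> carrier_mat n n"
  shows "unitary_diag n A U d \<longleftrightarrow>
    (\<forall>i<n. \<forall>k<n. (\<Sum>j<n. A $$ (i, j) * U $$ (j, k)) = complex_of_real (d k) * U $$ (i, k))"
proof -
  note U' = unitary_matD[OF U]
  have *: "X = Y \<longleftrightarrow> (\<forall>i<n. \<forall>k<n. X $$ (i,k) = Y $$ (i,k))"
    if "X \<in> carrier_mat n n" "Y \<in> carrier_mat n n" for X Y :: "complex mat"
    using that by (auto intro!: eq_matI)
  have 1: "(A * U) $$ (i,k) = (\<Sum>j<n. A $$ (i, j) * U $$ (j, k))" if "i < n" "k < n" for i k
    using that A U' by (intro mat_mult_index) auto
  have 2: "(U * mat_diag n (\<lambda>k. complex_of_real (d k))) $$ (i,k) = complex_of_real (d k) * U $$ (i, k)"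
    if "i < n" "k < n" for i k
    using that U'(1) by (simp add: mat_diag_mult_right[of _ n])
  show ?thesis unfolding unitary_diag_iff[OF assms]
    by (subst *) (use A U' in \<open>auto simp: 1 2 simp del: index_mult_mat(1)\<close>)
qed

lemma unitary_diag_col:
  assumes "unitary_diag n A U d" "k < n"
  shows "eigenvector A (col U k) (complex_of_real (d k))"
proof -
  have U: "unitary_mat n U" using assms by (auto simp: unitary_diag_def)
  note U' = unitary_matD[OF U] and A = unitary_diag_carrier[OF assms(1)]
  have "A *\<^sub>v col U k = complex_of_real (d k) \<cdot>\<^sub>v col U k"
  proof (rule eq_vecI)
    fix i assume "i < dim_vec (complex_of_real (d k) \<cdot>\<^sub>v col U k)"
    then have i: "i < n" using U' by simp
    have "(A *\<^sub>v col U k) $ i = (\<Sum>l<n. A $$ (i, l) * U $$ (l, k))"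
      using i A U' assms(2) by (subst mat_mult_vec_index[of _ n n]) auto
    then show "(A *\<^sub>v col U k) $ i = (complex_of_real (d k) \<cdot>\<^sub>v col U k) $ i"
      using assms i U' unitary_diag_iff_index[OF U A, of d] by auto
  qed (use U' A in auto)
  moreover have "col U k \<noteq> 0\<^sub>v n"
  proof
    assume *: "col U k = 0\<^sub>v n"
    have "1 = (mat_adjoint U * U) $$ (k,k)" using U' assms(2) by simp
    also have "\<dots> = (\<Sum>l<n. mat_adjoint U $$ (k, l) * U $$ (l, k))"
      using assms(2) U' by (intro mat_mult_index) auto
    also have "\<dots> = 0"
    proof (intro sum.neutral ballI)
      fix l assume "l \<in> {..<n}"
      then have "U $$ (l, k) = 0" using arg_cong[OF *, of "\<lambda>x. x $ l"] U' assms(2) by simp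
      then show "mat_adjoint U $$ (k, l) * U $$ (l, k) = 0" by simp
    qed
    finally show False by simp
  qed
  ultimately show ?thesis using A U' assms(2) by (auto simp: eigenvector_def)
qed

text \<open>In the two eigenbases \<open>X\<close> becomes \<open>W\<close> with
  \<open>d i * W(i,j) = W(i,j) * e j\<close>, so \<open>W\<close> lives on pairs of equal
  eigenvalues; any change of eigenvalues that respects these coincidences is intertwined as well.
  Used for the independence of \<open>mat_fun\<close> from the diagonalization, for
  \<open>R * J = J * R\<close>, and to pass from matrices commuting with \<open>R\<close> to
  matrices commuting with \<open>J\<close>.\<close>

lemma unitary_diag_intertwine:
  assumes A: "unitary_diag n A U d" and B: "unitary_diag n B V e" and X: "X \<in> carrier_mat n n"
    and AX: "A * X = X * B" and de: "\<And>i j. i < n \<Longrightarrow> j < n \<Longrightarrow> d i = e j \<Longrightarrow> d' i = e' j"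
    and A': "unitary_diag n A' U d'" and B': "unitary_diag n B' V e'"
  shows "A' * X = X * B'"
proof -
  note [simp] = assoc_mult_mat[of _ n n _ n _ n] mult_carrier_mat[of _ n n]
  have U: "unitary_mat n U" and V: "unitary_mat n V" using A B by (auto simp: unitary_diag_def)
  note U = unitary_matD[OF U] and V = unitary_matD[OF V]
  note cU = cancel_left_mat[OF U(2,1,3)] cancel_left_mat[OF U(1,2,4)]
  note cV = cancel_left_mat[OF V(2,1,3)] cancel_left_mat[OF V(1,2,4)]
  let ?D = "\<lambda>d. mat_diag n (\<lambda>k. complex_of_real (d k))"
  define W where "W = mat_adjoint U * X * V"
  have W: "W \<in> carrier_mat n n" using U V X by (simp add: W_def)
  have "?D d * W = mat_adjoint U * (A * X) * V"
    using A U V X by (simp add: unitary_diag_def W_def cU[where m=n])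
  also have "\<dots> = W * ?D e"
    unfolding AX using B U V X by (simp add: unitary_diag_def W_def cV[where m=n])
  finally have DW: "?D d * W = W * ?D e" .
  have "?D d' * W = W * ?D e'"
  proof -
    have "complex_of_real (d' i) * W $$ (i,j) = W $$ (i,j) * complex_of_real (e' j)"
      if "i < n" "j < n" for i j
    proof -
      have "complex_of_real (d i) * W $$ (i,j) = W $$ (i,j) * complex_of_real (e j)"
        using arg_cong[OF DW, of "\<lambda>Y. Y $$ (i,j)"] that W
        by (simp add: mat_diag_mult_left[of _ n n] mat_diag_mult_right[of _ n n])
      then show ?thesis using de[OF that] by (cases "W $$ (i,j) = 0") (auto simp: mult.commute)
    qed
    then show ?thesis
      using W by (auto simp: mat_diag_mult_left[of _ n n] mat_diag_mult_right[of _ n n] intro: eq_matI)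
  qed
  then have "U * (?D d' * W) * mat_adjoint V = U * (W * ?D e') * mat_adjoint V" by simp
  then show ?thesis
    using A' B' U V X by (simp add: unitary_diag_def W_def cU[where m=n])
qed

text \<open>Uniqueness behind the definite description: if another diagonalization of
  \<open>A\<close> yields \<open>C\<close>, the identity intertwines \<open>A\<close> with itself,
  hence also \<open>C\<close> with \<open>?B\<close>.\<close>

lemma mat_fun_unitary_diag:
  assumes "unitary_diag n A U d"
  shows "unitary_diag n (mat_fun n f A) U (\<lambda>k. f (d k))"
proof -
  let ?P = "\<lambda>B. \<exists>U d. unitary_diag n A U d \<and> unitary_diag n B U (\<lambda>k. f (d k))"
  let ?B = "U * mat_diag n (\<lambda>k. complex_of_real (f (d k))) * mat_adjoint U"
  have B: "unitary_diag n ?B U (\<lambda>k. f (d k))" using assms by (simp add: unitary_diag_def)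
  have eq: "mat_fun n f A = (THE B. ?P B)"
    by (auto simp: mat_fun_def unitary_diag_def intro!: arg_cong[of _ _ The] ext)
  have "(THE B. ?P B) = ?B"
  proof (rule the_equality)
    show "?P ?B" using assms B by blast
    fix C assume "?P C"
    then obtain V e where V: "unitary_diag n A V e" and C: "unitary_diag n C V (\<lambda>k. f (e k))" by blast
    have A: "A \<in> carrier_mat n n" by (rule unitary_diag_carrier[OF assms])
    have "C * 1\<^sub>m n = 1\<^sub>m n * ?B"
      by (rule unitary_diag_intertwine[OF V assms _ _ _ C B]) (use A in auto)
    then show "C = ?B" using unitary_diag_carrier[OF C] unitary_diag_carrier[OF B]
      by (simp add: left_mult_one_mat[of _ n n] right_mult_one_mat[of _ n n])
  qed
  then show ?thesis using B by (simp add: eq)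
qed

section \<open>Characteristic polynomial and spectrum of a diagonalized matrix\<close>

lemma order_prod_linear_factors:
  fixes d :: "nat \<Rightarrow> complex"
  assumes "inj_on d {..<n}" "k < n"
  shows "order (d k) (\<Prod>j<n. [:- d j, 1:]) = 1"
proof -
  let ?q = "\<Prod>j\<in>{..<n} - {k}. [:- d j, 1:]"
  have eq: "(\<Prod>j<n. [:- d j, 1:]) = [:- d k, 1:] * ?q"
    using assms by (subst prod.remove[of _ k]) auto
  have "poly ?q (d k) \<noteq> 0"
    using assms by (auto simp: poly_prod dest: inj_onD)
  then have "order (d k) ?q = 0" and q: "?q \<noteq> 0" by (auto simp: order_0I)
  moreover have "order (d k) [:- d k, 1:] = 1"
    using order_power_n_n[of "d k" 1] by simp
  moreover have "[:- d k, 1:] * ?q \<noteq> 0" using q by (metis no_zero_divisors pCons_eq_0_iff zero_neq_one)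
  ultimately show ?thesis unfolding eq by (subst order_mult) (simp_all only:, simp)
qed

lemma unitary_diag_char_poly:
  assumes "unitary_diag n A U d"
  shows "char_poly A = (\<Prod>k<n. [:- complex_of_real (d k), 1:])"
proof -
  let ?D = "mat_diag n (\<lambda>k. complex_of_real (d k))"
  have U: "unitary_mat n U" using assms by (auto simp: unitary_diag_def)
  note U' = unitary_matD[OF U]
  have "similar_mat_wit A ?D U (mat_adjoint U)"
    by (rule similar_mat_witI[of _ _ n])
      (use U' unitary_diag_carrier[OF assms] assms in \<open>auto simp: unitary_diag_def\<close>)
  then have "char_poly A = char_poly ?D"
    by (intro char_poly_similar) (auto simp: similar_mat_def)
  also have "\<dots> = (\<Prod>a \<leftarrow> diag_mat ?D. [:- a, 1:])"
    by (rule char_poly_upper_triangular[of _ n]) auto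
  also have "diag_mat ?D = map (\<lambda>k. complex_of_real (d k)) [0..<n]"
    by (auto simp: diag_mat_def)
  also have "(\<Prod>a \<leftarrow> map (\<lambda>k. complex_of_real (d k)) [0..<n]. [:- a, 1:]) =
      (\<Prod>k<n. [:- complex_of_real (d k), 1:])"
    by (simp add: comp_def prod.distinct_set_conv_list[symmetric] atLeast0LessThan flip: atLeast_upt)
  finally show ?thesis .
qed

lemma unitary_diag_spectrum:
  assumes "unitary_diag n A U d"
  shows "spectrum A = (\<lambda>k. complex_of_real (d k)) ` {..<n}"
  by (auto simp: spectrum_root_char_poly[OF unitary_diag_carrier[OF assms]]
      unitary_diag_char_poly[OF assms] poly_prod)

lemma unitary_diag_simple_spectrum:
  assumes "unitary_diag n A U d" "inj_on d {..<n}"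
  shows "simple_spectrum A"
proof -
  have "inj_on (\<lambda>k. complex_of_real (d k)) {..<n}"
    using assms(2) by (auto simp: inj_on_def)
  from order_prod_linear_factors[OF this] show ?thesis
    by (auto simp: simple_spectrum_def unitary_diag_spectrum[OF assms(1)]
        unitary_diag_char_poly[OF assms(1)])
qed

section \<open>The spectral theorem for self-adjoint matrices\<close>

lemma unitary_mat_index_iff:
  assumes "U \<in> carrier_mat n n"
  shows "unitary_mat n U \<longleftrightarrow>
    (\<forall>i<n. \<forall>j<n. (\<Sum>l<n. cnj (U $$ (l, i)) * U $$ (l, j)) = (if i = j then 1 else 0))"
proof -
  have "(mat_adjoint U * U) $$ (i, j) = (\<Sum>l<n. cnj (U $$ (l, i)) * U $$ (l, j))"
    if "i < n" "j < n" for i j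
    using that assms by (subst mat_mult_index[of _ n n _ n]) auto
  moreover have "mat_adjoint U * U = 1\<^sub>m n \<longleftrightarrow>
      (\<forall>i<n. \<forall>j<n. (mat_adjoint U * U) $$ (i, j) = (1\<^sub>m n) $$ (i, j))"
    using assms by (auto intro!: eq_matI simp del: index_mult_mat(1))
  ultimately show ?thesis using assms by (simp add: unitary_mat_def)
qed

lemma conjugate_complex_cnj [simp]: "conjugate (z :: complex) = cnj z"
  by (simp add: conjugate_complex_def)

text \<open>Gram-Schmidt applied to a completion of \<open>v\<close> to a basis keeps
  \<open>v\<close> as its first vector and produces orthogonal vectors; dividing by their norms
  \<open>sqrt (r i)\<close> makes the matrix unitary.\<close>

lemma unitary_mat_first_col:
  fixes v :: "complex vec"
  assumes v: "v \<in> carrier_vec n" "v \<noteq> 0\<^sub>v n"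
  obtains W c where "unitary_mat n W" "col W 0 = c \<cdot>\<^sub>v v" 
proof -
  interpret cof_vec_space n "TYPE(complex)" .
  define b where "b = basis_completion v"
  define ws where "ws = gram_schmidt n b"
  have n: "n \<noteq> 0" using v by (metis carrier_vecD eq_vecI index_zero_vec(2) less_nat_zero_code)
  note bc = basis_completion[OF v, folded b_def]
  note gs = gram_schmidt_result[OF bc(2,4,5) ws_def]
  have len: "length ws = n" using gs bc by simp
  have hd: "ws ! 0 = v"
  proof -
    obtain vs where "b = v # vs" using bc n by (cases b) auto
    then show ?thesis using gram_schmidt_hd[OF v(1), of vs] n len
      by (simp add: ws_def hd_conv_nth flip: length_greater_0_conv)
  qed
  have wsc: "ws ! i \<in> carrier_vec n" if "i < n" for i using gs(3) len that by auto
  define r where "r i = (\<Sum>l<n. (cmod (ws ! i $ l))\<^sup>2)" for i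
  have ip: "ws ! i \<bullet>c ws ! j = (\<Sum>l<n. ws ! i $ l * cnj (ws ! j $ l))" if "i < n" "j < n" for i j
    using that wsc by (auto simp: scalar_prod_def atLeast0LessThan intro!: sum.cong)
  have rr: "ws ! i \<bullet>c ws ! i = complex_of_real (r i)" if "i < n" for i
    unfolding r_def ip[OF that that] by (simp del: of_real_power add: complex_norm_square)
  have rpos: "r i > 0" if "i < n" for i
  proof -
    have "r i \<noteq> 0" using corthogonalD[OF gs(2), of i i] len that rr[OF that] by auto
    moreover have "r i \<ge> 0" by (auto simp: r_def intro!: sum_nonneg)
    ultimately show ?thesis by simp
  qed
  define W where "W = mat n n (\<lambda>(l, i). ws ! i $ l / complex_of_real (sqrt (r i)))"
  have "unitary_mat n W"
  proof (subst unitary_mat_index_iff)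
    show "\<forall>i<n. \<forall>j<n. (\<Sum>l<n. cnj (W $$ (l, i)) * W $$ (l, j)) = (if i = j then 1 else 0)"
    proof (intro allI impI)
      fix i j assume ij: "i < n" "j < n"
      have "(\<Sum>l<n. cnj (W $$ (l, i)) * W $$ (l, j)) =
          (ws ! j \<bullet>c ws ! i) / complex_of_real (sqrt (r i) * sqrt (r j))"
        using ij by (simp add: W_def ip sum_divide_distrib mult.commute)
      also have "\<dots> = (if i = j then 1 else 0)"
      proof (cases "i = j")
        case True
        then show ?thesis using rr[OF ij(1)] rpos[OF ij(1)] by (simp flip: of_real_mult)
      next
        case False
        then show ?thesis using corthogonalD[OF gs(2), of j i] len ij by simp
      qed
      finally show "(\<Sum>l<n. cnj (W $$ (l, i)) * W $$ (l, j)) = (if i = j then 1 else 0)" .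
    qed
  qed (simp add: W_def)
  moreover have "col W 0 = (1 / complex_of_real (sqrt (r 0))) \<cdot>\<^sub>v v"
    using n v by (intro eq_vecI) (auto simp: W_def hd)
  ultimately show ?thesis by (rule that)
qed

text \<open>Induction by deflation: a unitary \<open>W\<close> whose first column is an eigenvector
  turns \<open>A\<close> into \<open>B\<close> with first column \<open>e\<close> times the first
  unit vector. Self-adjointness clears the first row too, and the induction hypothesis applies to
  the remaining block \<open>C\<close>.\<close>

theorem hermitian_unitary_diag:
  fixes A :: "complex mat"
  assumes "A \<in> carrier_mat n n" "mat_adjoint A = A"
  shows "\<exists>U d. unitary_diag n A U d"
  using assms
proof (induction n arbitrary: A)
  case 0
  then show ?case
    by (intro exI[of _ "1\<^sub>m 0"] exI[of _ "\<lambda>_. 0"])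
      (auto simp: unitary_diag_def unitary_mat_def intro!: eq_matI)
next
  case (Suc n)
  note [simp] = assoc_mult_mat[of _ "Suc n" "Suc n" _ "Suc n" _ "Suc n"]
    mult_carrier_mat[of _ "Suc n" "Suc n" _ "Suc n"]
  let ?N = "Suc n"
  from spectrum_non_empty[OF Suc.prems(1)] obtain e v where "eigenvector A v e"
    by (auto simp: spectrum_def eigenvalue_def)
  with Suc.prems have v: "v \<in> carrier_vec ?N" "v \<noteq> 0\<^sub>v ?N" and Av: "A *\<^sub>v v = e \<cdot>\<^sub>v v"
    by (auto simp: eigenvector_def)
  from unitary_mat_first_col[OF v] obtain W c where W: "unitary_mat ?N W" and c: "col W 0 = c \<cdot>\<^sub>v v" .
  note W' = unitary_matD[OF W]
  define B where "B = mat_adjoint W * A * W"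
  have B: "B \<in> carrier_mat ?N ?N" using W' Suc.prems by (simp add: B_def)
  have Bh: "mat_adjoint B = B"
    using W' Suc.prems by (simp add: B_def mat_adjoint_mult[of _ ?N ?N _ ?N])
  have B0: "B $$ (i, 0) = (if i = 0 then e else 0)" if "i < ?N" for i
  proof -
    have Aw: "(A * W) $$ (l, 0) = e * W $$ (l, 0)" if "l < ?N" for l
    proof -
      have "(A * W) $$ (l, 0) = (A *\<^sub>v col W 0) $ l" using that Suc.prems W' by simp
      also have "\<dots> = c * (A *\<^sub>v v) $ l" using that Suc.prems v by (simp add: c)
      also have "\<dots> = e * (col W 0) $ l" using that v by (simp add: c Av)
      finally show ?thesis using that W' by simp
    qed
    have "B $$ (i, 0) = (mat_adjoint W * (A * W)) $$ (i, 0)"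
      using W' Suc.prems by (simp add: B_def)
    also have "\<dots> = (\<Sum>l<?N. mat_adjoint W $$ (i, l) * (e * W $$ (l, 0)))"
      using W' Suc.prems that by (subst mat_mult_index[of _ ?N ?N _ ?N]) (auto simp: Aw simp del: index_mult_mat(1))
    also have "\<dots> = e * (\<Sum>l<?N. mat_adjoint W $$ (i, l) * W $$ (l, 0))"
      by (simp only: sum_distrib_left ac_simps)
    also have "(\<Sum>l<?N. mat_adjoint W $$ (i, l) * W $$ (l, 0)) = (mat_adjoint W * W) $$ (i, 0)"
      using W' that by (subst mat_mult_index[of _ ?N ?N _ ?N]) auto
    finally show ?thesis using W' that by auto
  qed
  have Bsym: "B $$ (i, j) = cnj (B $$ (j, i))" if "i < ?N" "j < ?N" for i j
    using that B by (subst Bh[symmetric]) auto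
  \<comment> \<open>\<open>e\<close> is a diagonal entry of the self-adjoint \<open>B\<close>; being
    real, it may head the real list \<open>d'\<close>.\<close>
  have e: "e = complex_of_real (Re e)"
    using Bsym[of 0 0] B0[of 0] by (auto simp: complex_eq_iff)
  define C where "C = mat n n (\<lambda>(i, j). B $$ (Suc i, Suc j))"
  have "mat_adjoint C = C"
    by (rule eq_matI) (auto simp: C_def, (subst Bsym, auto)+)
  then obtain U d where U: "unitary_diag n C U d"
    using Suc.IH[of C] by (auto simp: C_def)
  have UU: "unitary_mat n U" using U by (auto simp: unitary_diag_def)
  note U' = unitary_matD[OF UU]
  \<comment> \<open>The block sum of the scalar 1 and \<open>U\<close>, hence the index shift by
    one.\<close>
  define V where "V = mat ?N ?N (\<lambda>(i, j). if i = 0 \<or> j = 0 then (if i = j then 1 else 0) else U $$ (i - 1, j - 1))"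
  define d' where "d' k = (if k = 0 then Re e else d (k - 1))" for k
  have V: "unitary_mat ?N V"
  proof (subst unitary_mat_index_iff)
    have *: "(\<Sum>l<n. cnj (U $$ (l, i)) * U $$ (l, j)) = (if i = j then 1 else 0)" if "i < n" "j < n" for i j
      using UU unitary_mat_index_iff[OF U'(1)] that by blast
    show "\<forall>i<?N. \<forall>j<?N. (\<Sum>l<?N. cnj (V $$ (l, i)) * V $$ (l, j)) = (if i = j then 1 else 0)"
      by (intro allI impI, unfold sum.lessThan_Suc_shift, rename_tac i j, case_tac i; case_tac j)
        (auto simp: * V_def)
  qed (simp add: V_def)
  note V' = unitary_matD[OF V]
  have BV: "unitary_diag ?N B V d'"
  proof (subst unitary_diag_iff_index[OF V B], intro allI impI)
    fix i k assume ik: "i < ?N" "k < ?N"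
    have *: "(\<Sum>j<n. C $$ (i, j) * U $$ (j, k)) = complex_of_real (d k) * U $$ (i, k)"
      if "i < n" "k < n" for i k
      using U unitary_diag_iff_index[OF UU, of C d] that by (auto simp: C_def)
    have B0': "B $$ (0, j) = (if j = 0 then e else 0)" if "j < ?N" for j
      using Bsym[of 0 j] B0[OF that] that e by (auto simp: complex_eq_iff)
    show "(\<Sum>j<?N. B $$ (i, j) * V $$ (j, k)) = complex_of_real (d' k) * V $$ (i, k)"
      unfolding sum.lessThan_Suc_shift
      using ik *[of "i - 1" "k - 1"] B0 B0' e
      by (cases i; cases k) (auto simp: V_def d'_def C_def)
  qed
  have "unitary_mat ?N (W * V)" by (rule unitary_mat_mult[OF W V])
  moreover have "A * (W * V) = (W * V) * mat_diag ?N (\<lambda>k. complex_of_real (d' k))"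
  proof -
    have "A * W = W * B"
      using W' Suc.prems by (simp add: B_def cancel_left_mat[OF W'(1,2,4), where m="?N"])
    moreover have "B * V = V * mat_diag ?N (\<lambda>k. complex_of_real (d' k))"
      using BV unitary_diag_iff[OF V B] by simp
    ultimately show ?thesis using W' V' B Suc.prems
      by (simp flip: assoc_mult_mat[of A ?N ?N _ ?N _ ?N])
  qed
  ultimately have "unitary_diag ?N A (W * V) d'"
    using Suc.prems by (subst unitary_diag_iff) auto
  then show ?case by blast
qed

section \<open>Uniqueness of eigenbases and of orthonormal polynomials\<close>

lemma unitary_mat_adjoint:
  assumes "unitary_mat n U" shows "unitary_mat n (mat_adjoint U)"
  unfolding unitary_mat_def using unitary_matD[OF assms] by simp

lemma hermitian_index:
  fixes A :: "complex mat"
  assumes "A \<in> carrier_mat n n" "mat_adjoint A = A" "i < n" "j < n"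
  shows "A $$ (i, j) = cnj (A $$ (j, i))"
proof -
  have "mat_adjoint A $$ (i, j) = cnj (A $$ (j, i))"
    using assms(1,3,4) by (intro mat_adjoint_index) auto
  then show ?thesis by (simp only: assms(2))
qed

text \<open>The change of basis \<open>W = V^H U\<close> intertwines \<open>diag d\<close> with
  \<open>diag z\<close>. Since \<open>d\<close> is injective, column \<open>k\<close> of
  \<open>W\<close> is supported in the single row \<open>p k\<close> with
  \<open>d (p k) = z k\<close>, so \<open>W\<close> is a permutation matrix with entries of modulus
  1.\<close>

lemma unique_eigenbasis_unitary_diag:
  assumes A: "unitary_diag n A V d" and inj: "inj_on d {..<n}"
  shows "unique_orthonormal_eigenbasis n A V"
proof -
  have V: "unitary_mat n V" using A by (auto simp: unitary_diag_def)
  note V' = unitary_matD[OF V] and Ac = unitary_diag_carrier[OF A]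
  have "same_up_to_order_and_phase n U V" if U: "orthonormal_eigenbasis n A U" for U
  proof -
    have UU: "unitary_mat n U" using U by (auto simp: orthonormal_eigenbasis_def)
    note U' = unitary_matD[OF UU]
    from U obtain z where z: "eigenvector A (col U k) (z k)" if "k < n" for k
      unfolding orthonormal_eigenbasis_def by metis
    define W where "W = mat_adjoint V * U"
    have W: "unitary_mat n W"
      unfolding W_def by (intro unitary_mat_mult unitary_mat_adjoint V UU)
    note W' = unitary_matD[OF W]
    have UW: "U = V * W" using V' U' by (simp add: W_def cancel_left_mat[where n=n and m=n])
    have AU: "A * U = U * mat_diag n z"
    proof (rule eq_matI)
      fix i k assume "i < dim_row (U * mat_diag n z)" "k < dim_col (U * mat_diag n z)"
      then have ik: "i < n" "k < n" using U' by auto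
      have "(A * U) $$ (i, k) = (A *\<^sub>v col U k) $ i" using ik Ac U' by simp
      also have "\<dots> = z k * U $$ (i, k)" using z[OF ik(2)] ik U' by (simp add: eigenvector_def)
      finally show "(A * U) $$ (i, k) = (U * mat_diag n z) $$ (i, k)"
        using ik U' by (simp add: mat_diag_mult_right[of _ n n])
    qed (use Ac U' in auto)
    have "mat_diag n (\<lambda>k. complex_of_real (d k)) * W = W * mat_diag n z"
    proof -
      note [simp] = assoc_mult_mat[of _ n n _ n _ n] mult_carrier_mat[of _ n n]
      have "V * (mat_diag n (\<lambda>k. complex_of_real (d k)) * W) = A * U"
      proof -
        have "A * (V * W) = (A * V) * W" using Ac V' W' by (simp only: assoc_mult_mat)
        also have "A * V = V * mat_diag n (\<lambda>k. complex_of_real (d k))"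
          using A by (simp add: unitary_diag_iff[OF V Ac])
        finally show ?thesis using V' W' by (simp add: UW)
      qed
      also have "\<dots> = V * (W * mat_diag n z)"
        unfolding AU using V' W' by (simp add: UW)
      finally have "mat_adjoint V * (V * (mat_diag n (\<lambda>k. complex_of_real (d k)) * W)) =
          mat_adjoint V * (V * (W * mat_diag n z))" by simp
      then show ?thesis using V' W' by (simp add: cancel_left_mat[OF V'(2,1,3), where m=n])
    qed
    note DW_mat = this
    have DW: "complex_of_real (d i) * W $$ (i, k) = W $$ (i, k) * z k" if "i < n" "k < n" for i k
      using arg_cong[OF DW_mat, of "\<lambda>Y. Y $$ (i, k)"] that W'
      by (simp add: mat_diag_mult_left[of _ n n] mat_diag_mult_right[of _ n n])
    have orth: "(\<Sum>l<n. cnj (W $$ (l, i)) * W $$ (l, j)) = (if i = j then 1 else 0)"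
      if "i < n" "j < n" for i j
      using W unitary_mat_index_iff[OF W'(1)] that by blast
    have "\<exists>i<n. W $$ (i, k) \<noteq> 0" if "k < n" for k
      using orth[OF that that] by (metis (no_types, lifting) lessThan_iff mult_zero_right sum.neutral zero_neq_one)
    then obtain p where p: "p k < n" "W $$ (p k, k) \<noteq> 0" if "k < n" for k by metis
    have dz: "complex_of_real (d (p k)) = z k" if "k < n" for k
      using DW[OF p(1)[OF that] that] p[OF that] by simp
    have W0: "W $$ (i, k) = 0" if "i < n" "k < n" "i \<noteq> p k" for i k
    proof (rule ccontr)
      assume "W $$ (i, k) \<noteq> 0"
      then have "complex_of_real (d i) = complex_of_real (d (p k))"
        using DW[OF that(1,2)] dz[OF that(2)] by simp
      then show False using inj that p[OF that(2)] by (auto dest: inj_onD)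
    qed
    have sum_W: "(\<Sum>l<n. g l * W $$ (l, k)) = g (p k) * W $$ (p k, k)" if "k < n" for g k
    proof -
      have "(\<Sum>l<n. g l * W $$ (l, k)) = (\<Sum>l<n. if l = p k then g l * W $$ (l, k) else 0)"
        using W0 that by (intro sum.cong) auto
      then show ?thesis using p(1)[OF that] by simp
    qed
    \<comment> \<open>Two columns of \<open>W\<close> supported in the same row could not be
      orthogonal.\<close>
    have injp: "inj_on p {..<n}"
    proof (rule inj_onI, rule ccontr)
      fix k l assume kl: "k \<in> {..<n}" "l \<in> {..<n}" "p k = p l" "k \<noteq> l"
      then have "cnj (W $$ (p l, k)) * W $$ (p l, l) = 0"
        using orth[of k l] sum_W[of l "\<lambda>i. cnj (W $$ (i, k))"] by simp
      then show False using p[of k] p[of l] kl by simp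
    qed
    define \<pi> where "\<pi> k = (if k < n then p k else k)" for k
    have "\<pi> permutes {..<n}"
    proof (rule bij_imp_permutes)
      have "inj_on \<pi> {..<n}" using injp by (auto simp: inj_on_def \<pi>_def)
      moreover have "\<pi> ` {..<n} \<subseteq> {..<n}" using p by (auto simp: \<pi>_def)
      ultimately show "bij_betw \<pi> {..<n} {..<n}"
        by (auto simp: bij_betw_def endo_inj_surj)
    qed (simp add: \<pi>_def)
    moreover have "cmod (W $$ (p k, k)) = 1" if "k < n" for k
    proof -
      have "cnj (W $$ (p k, k)) * W $$ (p k, k) = 1"
        using orth[OF that that] sum_W[OF that, of "\<lambda>i. cnj (W $$ (i, k))"] by simp
      then have "complex_of_real ((cmod (W $$ (p k, k)))\<^sup>2) = 1"
        by (simp add: complex_norm_square mult.commute del: of_real_power)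
      then have "(cmod (W $$ (p k, k)))\<^sup>2 = 1" by (simp only: of_real_eq_1_iff)
      then show ?thesis using abs_square_eq_1[of "cmod (W $$ (p k, k))"] by simp
    qed
    moreover have "col U k = W $$ (p k, k) \<cdot>\<^sub>v col V (p k)" if "k < n" for k
    proof (rule eq_vecI)
      fix i assume "i < dim_vec (W $$ (p k, k) \<cdot>\<^sub>v col V (p k))"
      then have i: "i < n" using V' by simp
      have "U $$ (i, k) = (\<Sum>l<n. V $$ (i, l) * W $$ (l, k))"
        using i that V' W' by (subst UW, subst mat_mult_index[of _ n n _ n]) auto
      then show "col U k $ i = (W $$ (p k, k) \<cdot>\<^sub>v col V (p k)) $ i"
        using i that U' V' p(1)[OF that] by (simp add: sum_W)
    qed (use U' V' in auto)
    ultimately show ?thesis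
      unfolding same_up_to_order_and_phase_def
      by (intro exI[of _ \<pi>] exI[of _ "\<lambda>k. W $$ (p k, k)"]) (auto simp: \<pi>_def)
  qed
  moreover have "orthonormal_eigenbasis n A V"
    using V unitary_diag_col[OF A] by (auto simp: orthonormal_eigenbasis_def)
  ultimately show ?thesis by (auto simp: unique_orthonormal_eigenbasis_def)
qed

lemma hermitian_eigenvectors_orthogonal:
  fixes A :: "complex mat" and x y :: real
  assumes A: "A \<in> carrier_mat n n" "mat_adjoint A = A"
    and u: "eigenvector A u (complex_of_real x)" and v: "eigenvector A v (complex_of_real y)"
    and xy: "x \<noteq> y"
  shows "(\<Sum>i<n. cnj (u $ i) * v $ i) = 0"
proof -
  have Au: "(\<Sum>j<n. A $$ (i, j) * u $ j) = complex_of_real x * u $ i" if "i < n" for i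
    using that A u mat_mult_vec_index[of A n n u i] by (auto simp: eigenvector_def)
  have Av: "(\<Sum>j<n. A $$ (i, j) * v $ j) = complex_of_real y * v $ i" if "i < n" for i
    using that A v mat_mult_vec_index[of A n n v i] by (auto simp: eigenvector_def)
  note herm = hermitian_index[OF A]
  have "complex_of_real x * (\<Sum>i<n. cnj (u $ i) * v $ i) =
      (\<Sum>i<n. cnj (\<Sum>j<n. A $$ (i, j) * u $ j) * v $ i)"
    by (simp add: Au sum_distrib_left mult.assoc)
  also have "\<dots> = (\<Sum>i<n. \<Sum>j<n. cnj (A $$ (i, j)) * cnj (u $ j) * v $ i)"
    by (simp add: cnj_sum sum_distrib_right)
  also have "\<dots> = (\<Sum>j<n. \<Sum>i<n. cnj (A $$ (i, j)) * cnj (u $ j) * v $ i)"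
    by (rule sum.swap)
  also have "\<dots> = (\<Sum>j<n. \<Sum>i<n. cnj (u $ j) * (A $$ (j, i) * v $ i))"
  proof (intro sum.cong refl)
    fix i j assume "j \<in> {..<n}" "i \<in> {..<n}"
    then have "cnj (A $$ (i, j)) = A $$ (j, i)" using herm[of j i] by simp
    then show "cnj (A $$ (i, j)) * cnj (u $ j) * v $ i = cnj (u $ j) * (A $$ (j, i) * v $ i)"
      by (simp add: mult_ac)
  qed
  also have "\<dots> = (\<Sum>j<n. cnj (u $ j) * (complex_of_real y * v $ j))"
    by (intro sum.cong refl) (simp add: Av flip: sum_distrib_left)
  also have "\<dots> = complex_of_real y * (\<Sum>i<n. cnj (u $ i) * v $ i)"
    by (simp add: sum_distrib_left mult.left_commute)
  finally show ?thesis using xy by simp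
qed

section \<open>Uniqueness of orthonormal polynomials up to sign\<close>

lemma orthonormal_polys_nonzero:
  assumes "orthonormal_polys n \<mu> w p" "i < n"
  shows "p i \<noteq> 0"
proof
  assume "p i = 0"
  then have "(\<Sum>k<n. w k * poly (p i) (\<mu> k) * poly (p i) (\<mu> k)) = 0" by simp
  then show False using assms by (auto simp: orthonormal_polys_def)
qed

text \<open>Induction on \<open>m\<close>: subtracting a multiple of \<open>p m\<close> removes the
  coefficient of order \<open>m\<close> from \<open>r\<close>. The bound is phrased by vanishing
  coefficients because at \<open>m = 0\<close> it has to say that \<open>r\<close> is zero, which
  \<open>degree\<close> cannot express.\<close>

lemma orthonormal_polys_orthogonal:
  assumes p: "orthonormal_polys n \<mu> w p" and m: "m \<le> i" "i < n"
    and r: "\<And>j. j \<ge> m \<Longrightarrow> coeff r j = 0"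
  shows "(\<Sum>k<n. w k * poly (p i) (\<mu> k) * poly r (\<mu> k)) = 0"
  using m(1) r
proof (induction m arbitrary: r)
  case 0
  then have "r = 0" by (intro poly_eqI) auto
  then show ?case by simp
next
  case (Suc m)
  have mn: "m < n" "m \<noteq> i" using Suc.prems m by auto
  have deg: "degree (p m) = m" using p mn by (auto simp: orthonormal_polys_def)
  have "p m \<noteq> 0" by (rule orthonormal_polys_nonzero[OF p mn(1)])
  then have lc: "coeff (p m) m \<noteq> 0" using deg leading_coeff_neq_0 by metis
  define c where "c = coeff r m / coeff (p m) m"
  define s where "s = r - Polynomial.smult c (p m)"
  have "coeff s j = 0" if "j \<ge> m" for j
  proof (cases "j = m")
    case True then show ?thesis using lc by (simp add: s_def c_def)
  next
    case False
    then have "coeff (p m) j = 0" using deg that by (intro coeff_eq_0) auto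
    then show ?thesis using Suc.prems(2)[of j] False that by (simp add: s_def)
  qed
  from Suc.IH[OF _ this] have "(\<Sum>k<n. w k * poly (p i) (\<mu> k) * poly s (\<mu> k)) = 0"
    using Suc.prems by simp
  moreover have "(\<Sum>k<n. w k * poly (p i) (\<mu> k) * poly (p m) (\<mu> k)) = 0"
    using p mn m by (auto simp: orthonormal_polys_def)
  moreover have "r = s + Polynomial.smult c (p m)" by (simp add: s_def)
  ultimately show ?case
    by (simp add: ring_distribs sum.distrib mult.left_commute[of _ c] flip: sum_distrib_left)
qed

text \<open>Matching leading coefficients makes \<open>h\<close> of lower degree, hence orthogonal
  to \<open>p i\<close> and \<open>q i\<close> and so to itself. Positive weights then make
  \<open>h\<close> vanish at every node.\<close>

lemma orthonormal_polys_unique: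
  assumes p: "orthonormal_polys n \<mu> w p" and q: "orthonormal_polys n \<mu> w q"
    and w: "\<And>k. k < n \<Longrightarrow> w k > 0" and i: "i < n" and k: "k < n"
  shows "poly (p i) (\<mu> k) =
    sgn (lead_coeff (p i)) * sgn (lead_coeff (q i)) * poly (q i) (\<mu> k)"
proof -
  define c where "c = lead_coeff (p i) / lead_coeff (q i)"
  define h where "h = p i - Polynomial.smult c (q i)"
  let ?ip = "\<lambda>f g. \<Sum>k<n. w k * poly f (\<mu> k) * poly g (\<mu> k)"
  have nz: "lead_coeff (p i) \<noteq> 0" "lead_coeff (q i) \<noteq> 0"
    using orthonormal_polys_nonzero[OF p i] orthonormal_polys_nonzero[OF q i] by auto
  have deg: "degree (p i) = i" "degree (q i) = i" using p q i by (auto simp: orthonormal_polys_def)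
  have "coeff h j = 0" if "j \<ge> i" for j
  proof (cases "j = i")
    case True then show ?thesis using nz deg by (simp add: h_def c_def)
  next
    case False
    then show ?thesis using deg that by (simp add: h_def coeff_eq_0)
  qed
  then have ph: "?ip (p i) h = 0" and qh: "?ip (q i) h = 0"
    using orthonormal_polys_orthogonal[OF p _ i, of i h] orthonormal_polys_orthogonal[OF q _ i, of i h] by auto
  have ip_h: "?ip f h = ?ip f (p i) - c * ?ip f (q i)" for f
    unfolding sum_distrib_left sum_subtractf[symmetric]
    by (intro sum.cong refl) (simp add: h_def algebra_simps)
  have ip_commute: "?ip f g = ?ip g f" for f g by (simp add: mult_ac)
  have "?ip h h = 0" using ip_h[of h] ip_commute[of h "p i"] ip_commute[of h "q i"] ph qh by simp
  moreover have "w k * poly h (\<mu> k) * poly h (\<mu> k) \<ge> 0" if "k < n" for k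
    using w[OF that] by (simp add: mult.assoc)
  ultimately have "w k * poly h (\<mu> k) * poly h (\<mu> k) = 0"
    using k by (subst (asm) sum_nonneg_eq_0_iff) auto
  then have "poly h (\<mu> k) = 0" using w[OF k] by simp
  then have eq: "poly (p i) (\<mu> k) = c * poly (q i) (\<mu> k)" by (simp add: h_def)
  have "?ip (p i) (p i) = 1" "?ip (q i) (q i) = 1"
    using p q i by (auto simp: orthonormal_polys_def)
  \<comment> \<open>Orthogonality of \<open>p i\<close> and \<open>h\<close> reads
    \<open>1 = c * ?ip (p i) (q i)\<close>, that of \<open>q i\<close> and \<open>h\<close> reads
    \<open>?ip (q i) (p i) = c\<close>.\<close>
  then have "c * c = 1"
    using ip_h[of "p i"] ip_h[of "q i"] ip_commute[of "q i" "p i"] ph qh by simp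
  then have "\<bar>c\<bar> = 1" using abs_square_eq_1[of c] by (simp add: power2_eq_square)
  then have "c = 1 \<or> c = -1" by linarith
  then have "c = sgn c" by auto
  also have "sgn c = sgn (lead_coeff (p i)) * sgn (lead_coeff (q i))"
    unfolding c_def sgn_divide using nz by (auto simp: sgn_if)
  finally show ?thesis using eq by simp
qed

section \<open>Jacobi matrices\<close>

locale jacobi =
  fixes M :: nat and J :: "complex mat"
  assumes jacobi: "jacobi_matrix M J" and M_pos: "M > 0"
begin

definition jc :: "nat \<Rightarrow> nat \<Rightarrow> real" where "jc i j = Re (J $$ (i, j))"

lemma J_carrier [simp]: "J \<in> carrier_mat M M"
  using jacobi by (auto simp: jacobi_matrix_def sym_tridiagonal_def)

lemma J_dims [simp]: "dim_row J = M" "dim_col J = M"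
  using carrier_matD[OF J_carrier] by auto

lemma J_real: "i < M \<Longrightarrow> j < M \<Longrightarrow> J $$ (i, j) = complex_of_real (jc i j)"
  using jacobi by (force simp: jacobi_matrix_def sym_tridiagonal_def elements_mat_def jc_def)

lemma J_transpose: "transpose_mat J = J"
  using jacobi by (auto simp: jacobi_matrix_def sym_tridiagonal_def)

lemma J_sym: "i < M \<Longrightarrow> j < M \<Longrightarrow> J $$ (i, j) = J $$ (j, i)"
  by (metis J_carrier J_transpose carrier_matD index_transpose_mat(1))

lemma jc_sym: "i < M \<Longrightarrow> j < M \<Longrightarrow> jc i j = jc j i"
  by (simp add: jc_def J_sym)

lemma J_zero: "i < M \<Longrightarrow> j < M \<Longrightarrow> i + 1 < j \<or> j + 1 < i \<Longrightarrow> J $$ (i, j) = 0"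
  using jacobi by (auto simp: jacobi_matrix_def sym_tridiagonal_def)

lemma jc_off: "i + 1 < M \<Longrightarrow> jc i (i + 1) \<noteq> 0"
  using jacobi J_real[of i "i + 1"] by (auto simp: jacobi_matrix_def)

lemma J_hermitian: "mat_adjoint J = J"
proof (rule eq_matI)
  fix i j assume "i < dim_row J" "j < dim_col J"
  then have ij: "i < M" "j < M" by auto
  then show "mat_adjoint J $$ (i, j) = J $$ (i, j)"
    using carrier_matD[OF J_carrier] by (simp add: J_real jc_sym[of i j])
qed (use carrier_matD[OF J_carrier] in auto)

text \<open>Everything up to the diagonal stays in one sum, although at most two terms of it
  survive; row 0 then needs no separate treatment.\<close>

lemma J_row_sum:
  assumes "i + 1 < M"
  shows "(\<Sum>j<M. J $$ (i, j) * g j) = (\<Sum>j\<le>i. J $$ (i, j) * g j) + J $$ (i, i + 1) * g (i + 1)"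
proof -
  have "(\<Sum>j<M. J $$ (i, j) * g j) = (\<Sum>j\<le>i + 1. J $$ (i, j) * g j)"
    by (rule sum.mono_neutral_right) (use assms in \<open>auto simp: J_zero\<close>)
  then show ?thesis by simp
qed

text \<open>The three-term recurrence solved for the next polynomial, normalized by the constant 1,
  with the long sum of \<open>J_row_sum\<close>. From index \<open>M\<close> on the values depend on
  positions outside the matrix and carry no meaning.\<close>

fun jpoly :: "nat \<Rightarrow> real poly" where
  "jpoly 0 = 1"
| "jpoly (Suc i) = Polynomial.smult (1 / jc i (i + 1))
    ([:0, 1:] * jpoly i - (\<Sum>j\<in>{..i}. Polynomial.smult (jc i j) (jpoly j)))"

declare jpoly.simps(2) [simp del]

lemma eigenvector_jpoly:
  assumes v: "eigenvector J v (complex_of_real x)" and i: "i < M"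
  shows "v $ i = v $ 0 * complex_of_real (poly (jpoly i) x)"
  using i
proof (induction i rule: less_induct)
  case (less i)
  show ?case
  proof (cases i)
    case (Suc k)
    have k: "k + 1 < M" using less.prems Suc by simp
    have vc: "v \<in> carrier_vec M" using v by (auto simp: eigenvector_def)
    have "(J *\<^sub>v v) $ k = complex_of_real x * v $ k"
      using v k by (auto simp: eigenvector_def)
    then have "(\<Sum>j\<le>k. J $$ (k, j) * v $ j) + J $$ (k, k + 1) * v $ (k + 1) = complex_of_real x * v $ k"
      using k vc by (simp only: mat_mult_vec_index[OF J_carrier vc] J_row_sum)
    moreover have "(\<Sum>j\<le>k. J $$ (k, j) * v $ j) =
        v $ 0 * complex_of_real (\<Sum>j\<le>k. jc k j * poly (jpoly j) x)"
      unfolding of_real_sum sum_distrib_left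
    proof (intro sum.cong refl)
      fix j assume "j \<in> {..k}"
      then have "j < i" "j < M" using Suc k by auto
      then show "J $$ (k, j) * v $ j = v $ 0 * complex_of_real (jc k j * poly (jpoly j) x)"
        using less.IH[of j] J_real[of k j] k by simp
    qed
    moreover have "v $ k = v $ 0 * complex_of_real (poly (jpoly k) x)"
      using less.IH[of k] Suc k by simp
    ultimately have "complex_of_real (jc k (k + 1)) * v $ i =
        v $ 0 * complex_of_real (x * poly (jpoly k) x - (\<Sum>j\<le>k. jc k j * poly (jpoly j) x))"
      using Suc k by (simp add: J_real algebra_simps)
    then have "v $ i = v $ 0 * complex_of_real (x * poly (jpoly k) x - (\<Sum>j\<le>k. jc k j * poly (jpoly j) x))
        / complex_of_real (jc k (k + 1))"
      using jc_off[OF k] by (simp add: field_simps)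
    then show ?thesis by (simp add: Suc poly_sum jpoly.simps(2))
  qed simp
qed

lemma eigenvector_first_nonzero:
  assumes "eigenvector J v (complex_of_real x)"
  shows "v $ 0 \<noteq> 0"
proof
  assume "v $ 0 = 0"
  then have "v = 0\<^sub>v M"
    using eigenvector_jpoly[OF assms] assms by (intro eq_vecI) (auto simp: eigenvector_def)
  then show False using assms by (auto simp: eigenvector_def)
qed

text \<open>The subtracted sum has degree at most \<open>k\<close>, so the top coefficient of
  \<open>jpoly (k + 1)\<close> comes from \<open>x * jpoly k\<close> alone, divided by a nonzero
  off-diagonal entry. The relation between leading coefficients is what the sign convention
  expresses.\<close>

lemma jpoly_degree:
  assumes "i < M"
  shows "degree (jpoly i) = i \<and> jpoly i \<noteq> 0 \<and>
    (i + 1 < M \<longrightarrow> lead_coeff (jpoly (i + 1)) = lead_coeff (jpoly i) / jc i (i + 1))"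
  using assms
proof (induction i rule: less_induct)
  case (less i)
  \<comment> \<open>A statement about the coefficient of order \<open>k + 1\<close> instead of
    \<open>lead_coeff\<close>: the degree is known only after this coefficient is seen to be
    nonzero.\<close>
  have top: "coeff (jpoly (k + 1)) (k + 1) = coeff (jpoly k) k / jc k (k + 1)"
    and le: "degree (jpoly (k + 1)) \<le> k + 1" if "\<forall>j\<le>k. degree (jpoly j) = j" for k
  proof -
    let ?S = "\<Sum>j\<in>{..k}. Polynomial.smult (jc k j) (jpoly j)"
    have S: "degree ?S \<le> k"
      using that by (intro degree_sum_le) (auto intro: order.trans[OF degree_smult_le])
    then have "coeff ?S (k + 1) = 0" by (intro coeff_eq_0) simp
    then show "coeff (jpoly (k + 1)) (k + 1) = coeff (jpoly k) k / jc k (k + 1)"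
      by (simp add: jpoly.simps(2))
    have "degree ([:0, 1:] * jpoly k) \<le> k + 1"
      using that degree_mult_le[of "[:0, 1:]" "jpoly k"] by simp
    then have "degree ([:0, 1:] * jpoly k - ?S) \<le> k + 1"
      using S by (intro degree_diff_le) auto
    then show "degree (jpoly (k + 1)) \<le> k + 1"
      using order.trans[OF degree_smult_le] by (simp add: jpoly.simps(2))
  qed
  have deg: "degree (jpoly i) = i \<and> jpoly i \<noteq> 0"
  proof (cases i)
    case (Suc k)
    have k: "k + 1 < M" "\<forall>j\<le>k. degree (jpoly j) = j" "jpoly k \<noteq> 0"
      using less Suc by auto
    then have "coeff (jpoly i) i \<noteq> 0"
      using top[OF k(2)] jc_off[OF k(1)] leading_coeff_neq_0[OF k(3)] Suc by auto
    then show ?thesis using le[OF k(2)] Suc le_degree[of "jpoly i" i] by auto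
  qed simp
  moreover have "lead_coeff (jpoly (i + 1)) = lead_coeff (jpoly i) / jc i (i + 1)" if i: "i + 1 < M"
  proof -
    have all: "\<forall>j\<le>i. degree (jpoly j) = j" using less deg by (auto simp: le_less)
    have "coeff (jpoly (i + 1)) (i + 1) \<noteq> 0"
      using top[OF all] jc_off[OF i] deg leading_coeff_neq_0[of "jpoly i"] by auto
    then have "degree (jpoly (i + 1)) = i + 1" using le[OF all] le_degree by (metis le_antisym)
    then show ?thesis using top[OF all] deg by simp
  qed
  ultimately show ?case by blast
qed

text \<open>Two columns for one eigenvalue \<open>x\<close> would both be nonzero multiples of the
  vector of the values \<open>poly (jpoly i) x\<close>. Their inner product would be a nonzero
  multiple of the sum of squares of these values, which is positive since
  \<open>jpoly 0 = 1\<close>.\<close>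

lemma unitary_diag_inj:
  assumes "unitary_diag M J U d"
  shows "inj_on d {..<M}"
proof (rule inj_onI, rule ccontr)
  fix k l assume kl: "k \<in> {..<M}" "l \<in> {..<M}" "d k = d l" "k \<noteq> l"
  have U: "unitary_mat M U" using assms by (auto simp: unitary_diag_def)
  note U' = unitary_matD[OF U]
  have ev: "eigenvector J (col U k) (complex_of_real (d l))" "eigenvector J (col U l) (complex_of_real (d l))"
    using unitary_diag_col[OF assms] kl by force+
  have Ui: "U $$ (i, k) = U $$ (0, k) * complex_of_real (poly (jpoly i) (d l))"
    "U $$ (i, l) = U $$ (0, l) * complex_of_real (poly (jpoly i) (d l))" if "i < M" for i
    using eigenvector_jpoly[OF ev(1) that] eigenvector_jpoly[OF ev(2) that] that kl U'(1) M_pos by auto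
  have nz: "U $$ (0, k) \<noteq> 0" "U $$ (0, l) \<noteq> 0"
    using eigenvector_first_nonzero[OF ev(1)] eigenvector_first_nonzero[OF ev(2)] kl U'(1) M_pos by auto
  have "0 = (\<Sum>i<M. cnj (U $$ (i, k)) * U $$ (i, l))"
    using U unitary_mat_index_iff[OF U'(1)] kl by auto
  also have "\<dots> = (\<Sum>i<M. cnj (U $$ (0, k)) * U $$ (0, l) * complex_of_real ((poly (jpoly i) (d l))\<^sup>2))"
  proof (intro sum.cong refl)
    fix i assume "i \<in> {..<M}"
    then have i: "i < M" by simp
    show "cnj (U $$ (i, k)) * U $$ (i, l) =
        cnj (U $$ (0, k)) * U $$ (0, l) * complex_of_real ((poly (jpoly i) (d l))\<^sup>2)"
      by (subst Ui(1)[OF i], subst Ui(2)[OF i]) (simp add: power2_eq_square mult_ac)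
  qed
  also have "\<dots> = cnj (U $$ (0, k)) * U $$ (0, l) * complex_of_real (\<Sum>i<M. (poly (jpoly i) (d l))\<^sup>2)"
    by (simp only: of_real_sum sum_distrib_left)
  finally have "(\<Sum>i<M. (poly (jpoly i) (d l))\<^sup>2) = 0" using nz by (simp del: of_real_sum)
  then have "\<forall>i\<in>{..<M}. (poly (jpoly i) (d l))\<^sup>2 = 0" by (subst (asm) sum_nonneg_eq_0_iff) auto
  then have "(poly (jpoly 0) (d l))\<^sup>2 = 0" using M_pos by blast
  then show False by simp
qed

lemma spectral_decomposition:
  obtains U d where "unitary_diag M J U d" "inj_on d {..<M}"
  using hermitian_unitary_diag[OF J_carrier J_hermitian] unitary_diag_inj by blast

text \<open>\<open>X\<close> is determined by its first column, because \<open>e\<^sub>0\<close> is a cyclic vector of \<open>J\<close>.\<close>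

lemma commuting_zero:
  assumes X: "X \<in> carrier_mat M M" and comm: "X * J = J * X"
    and X0: "\<And>r. r < M \<Longrightarrow> X $$ (r, 0) = 0"
  shows "X = 0\<^sub>m M M"
proof -
  have "X $$ (r, i) = 0" if "i < M" "r < M" for i r
    using that
  proof (induction i arbitrary: r rule: less_induct)
    case (less i)
    show ?case
    proof (cases i)
      case (Suc k)
      then have k: "k + 1 < M" using less.prems by simp
      \<comment> \<open>Entry \<open>(r, k)\<close> of \<open>X * J = J * X\<close>: with columns up
        to \<open>k\<close> zero, the left side reduces to a nonzero multiple of
        \<open>X $$ (r, k + 1)\<close>, while the right side involves only column
        \<open>k\<close>.\<close>
      have "(X * J) $$ (r, k) = (\<Sum>s<M. J $$ (k, s) * X $$ (r, s))"
        using mat_mult_index[OF X J_carrier less.prems(2), of k] k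
        by (simp add: J_sym[of k] mult.commute del: index_mult_mat(1))
      also have "\<dots> = J $$ (k, k + 1) * X $$ (r, k + 1)"
        using less Suc k by (simp add: J_row_sum)
      also have "(X * J) $$ (r, k) = (\<Sum>s<M. J $$ (r, s) * X $$ (s, k))"
        unfolding comm using mat_mult_index[OF J_carrier X less.prems(2), of k] k by simp
      also have "\<dots> = 0" using less.IH[of k] k Suc by (intro sum.neutral) auto
      finally show ?thesis using jc_off[OF k] J_real[of k "k + 1"] k Suc by simp
    qed (use X0 less.prems in simp)
  qed
  then show ?thesis using X by (intro eq_matI) auto
qed

text \<open>Entry 1 of the first column fixes \<open>\<alpha>\<close>, entry 0 then fixes the
  multiple of the identity, and \<open>A0\<close> matches the rest. The matrix \<open>A\<close> may
  be complex and need not be symmetric, as befits the complex combinations met when zero eigenvalues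
  are counted.\<close>

lemma commuting_tridiagonal:
  assumes M: "M \<ge> 2" and A: "A \<in> carrier_mat M M" and comm: "A * J = J * A"
    and A0: "\<And>r. 2 \<le> r \<Longrightarrow> r < M \<Longrightarrow> A $$ (r, 0) = 0"
  defines "\<alpha> \<equiv> A $$ (1, 0) / J $$ (1, 0)"
  shows "A = \<alpha> \<cdot>\<^sub>m J + (A $$ (0, 0) - \<alpha> * J $$ (0, 0)) \<cdot>\<^sub>m 1\<^sub>m M"
proof -
  define \<beta> where "\<beta> = A $$ (0, 0) - \<alpha> * J $$ (0, 0)"
  define X where "X = A - (\<alpha> \<cdot>\<^sub>m J + \<beta> \<cdot>\<^sub>m 1\<^sub>m M)"
  have X: "X \<in> carrier_mat M M" using A by (auto simp: X_def)
  have J10: "J $$ (1, 0) \<noteq> 0" using jc_off[of 0] J_real[of 0 1] J_sym[of 0 1] M by auto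
  define Y where "Y = \<alpha> \<cdot>\<^sub>m J + \<beta> \<cdot>\<^sub>m 1\<^sub>m M"
  have Y: "Y \<in> carrier_mat M M" and XY: "X = A - Y" by (auto simp: Y_def X_def)
  have "Y * J = \<alpha> \<cdot>\<^sub>m (J * J) + \<beta> \<cdot>\<^sub>m J"
    unfolding Y_def by (subst add_mult_distrib_mat[of _ M M _ _ M]) (auto simp: left_mult_one_mat[of _ M M])
  moreover have "J * Y = \<alpha> \<cdot>\<^sub>m (J * J) + \<beta> \<cdot>\<^sub>m J"
    unfolding Y_def by (subst mult_add_distrib_mat[of _ M M _ M]) (auto simp: right_mult_one_mat[of _ M M])
  ultimately have "X * J = J * X"
    unfolding XY using comm minus_mult_distrib_mat[OF A Y J_carrier] mult_minus_distrib_mat[OF J_carrier A Y]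
    by simp
  moreover have "X $$ (r, 0) = 0" if "r < M" for r
  proof -
    consider "r = 0" | "r = 1" | "r \<ge> 2" by linarith
    then show ?thesis
      using that A M A0[of r] J10 J_zero[of r 0] carrier_matD[OF J_carrier]
      by cases (auto simp: X_def \<alpha>_def \<beta>_def)
  qed
  ultimately have "X = 0\<^sub>m M M" using X commuting_zero by blast
  then have "X $$ (i, j) = 0" if "i < M" "j < M" for i j using that by simp
  then show ?thesis
    unfolding \<beta>_def[symmetric] using A carrier_matD[OF J_carrier]
    by (intro eq_matI) (auto simp: X_def)
qed

end

section \<open>Normalized eigenvectors, spectral weights and signs\<close>

context jacobi
begin

lemma unit_real_eigenvectorD:
  assumes "unit_real_eigenvector J x v"
  shows "eigenvector J v (complex_of_real x)" "v \<in> carrier_vec M"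
    "i < M \<Longrightarrow> v $ i = complex_of_real (Re (v $ i))"
    "(\<Sum>i<M. cnj (v $ i) * v $ i) = 1"
proof -
  show ev: "eigenvector J v (complex_of_real x)"
    using assms by (auto simp: unit_real_eigenvector_def)
  then show v: "v \<in> carrier_vec M" by (auto simp: eigenvector_def)
  show "v $ i = complex_of_real (Re (v $ i))" if "i < M"
    using assms v that by (auto simp: unit_real_eigenvector_def Reals_def)
  have "v \<bullet>c v = (\<Sum>i<M. v $ i * cnj (v $ i))"
    using v by (auto simp: scalar_prod_def atLeast0LessThan intro!: sum.cong)
  then show "(\<Sum>i<M. cnj (v $ i) * v $ i) = 1"
    using assms by (simp add: unit_real_eigenvector_def mult.commute)
qed

lemma eigenvector_matrix:
  assumes v: "\<And>k. k < M \<Longrightarrow> unit_real_eigenvector J (\<mu> k) (v k)" and inj: "inj_on \<mu> {..<M}"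
  shows "unitary_diag M J (mat M M (\<lambda>(i, k). v k $ i)) \<mu>"
proof -
  let ?V = "mat M M (\<lambda>(i, k). v k $ i)"
  have "(\<Sum>l<M. cnj (v i $ l) * v j $ l) = (if i = j then 1 else 0)" if "i < M" "j < M" for i j
  proof (cases "i = j")
    case True then show ?thesis using unit_real_eigenvectorD(4)[OF v[OF that(1)]] by simp
  next
    case False
    then have "\<mu> i \<noteq> \<mu> j" using inj that by (auto dest: inj_onD)
    then show ?thesis
      using hermitian_eigenvectors_orthogonal[OF J_carrier J_hermitian
          unit_real_eigenvectorD(1)[OF v[OF that(1)]] unit_real_eigenvectorD(1)[OF v[OF that(2)]]] False
      by simp
  qed
  then have V: "unitary_mat M ?V" by (subst unitary_mat_index_iff) auto
  have "(\<Sum>j<M. J $$ (i, j) * v k $ j) = complex_of_real (\<mu> k) * v k $ i" if "i < M" "k < M" for i k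
  proof -
    note vk = unit_real_eigenvectorD[OF v[OF that(2)]]
    have "(J *\<^sub>v v k) $ i = complex_of_real (\<mu> k) * v k $ i"
      using vk(1,2) that by (simp add: eigenvector_def)
    then show ?thesis by (simp only: mat_mult_vec_index[OF J_carrier vk(2) that(1)])
  qed
  then show ?thesis by (subst unitary_diag_iff_index[OF V J_carrier]) auto
qed

lemma jpoly_orthonormal:
  assumes v: "\<And>k. k < M \<Longrightarrow> unit_real_eigenvector J (\<mu> k) (v k)" and inj: "inj_on \<mu> {..<M}"
  shows "orthonormal_polys M \<mu> (spectral_weight v) jpoly"
proof -
  let ?V = "mat M M (\<lambda>(i, k). v k $ i)"
  have V: "unitary_mat M ?V" using eigenvector_matrix[OF assms] by (auto simp: unitary_diag_def)
  have "(\<Sum>k<M. spectral_weight v k * poly (jpoly i) (\<mu> k) * poly (jpoly j) (\<mu> k)) = (if i = j then 1 else 0)"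
    if ij: "i < M" "j < M" for i j
  proof -
    have "complex_of_real (\<Sum>k<M. spectral_weight v k * poly (jpoly i) (\<mu> k) * poly (jpoly j) (\<mu> k)) =
        (\<Sum>k<M. v k $ i * cnj (v k $ j))"
      unfolding of_real_sum
    proof (intro sum.cong refl)
      fix k assume "k \<in> {..<M}"
      then have k: "k < M" by simp
      note vk = unit_real_eigenvectorD[OF v[OF k]]
      define x where "x = Re (v k $ 0)"
      have "v k $ 0 = complex_of_real x" using vk(3)[OF M_pos] by (simp add: x_def)
      then have *: "v k $ l = complex_of_real (x * poly (jpoly l) (\<mu> k))" if "l < M" for l
        using eigenvector_jpoly[OF vk(1) that] by simp
      show "complex_of_real (spectral_weight v k * poly (jpoly i) (\<mu> k) * poly (jpoly j) (\<mu> k)) =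
          v k $ i * cnj (v k $ j)"
        by (simp add: *[OF ij(1)] *[OF ij(2)] spectral_weight_def flip: x_def)
          (simp add: power2_eq_square mult_ac)
    qed
    \<comment> \<open>Unitarity is defined through the columns; the orthonormality needed here is
      that of the rows, hence the reversed product.\<close>
    also have "\<dots> = (?V * mat_adjoint ?V) $$ (i, j)"
      using ij by (subst mat_mult_index[of _ M M _ M]) auto
    also have "\<dots> = (if i = j then 1 else 0)"
      unfolding unitary_matD(4)[OF V] using ij by simp
    finally show ?thesis by (auto split: if_splits simp del: of_real_sum)
  qed
  then show ?thesis using jpoly_degree by (auto simp: orthonormal_polys_def)
qed

text \<open>Dividing a complex eigenvector by its nonzero entry 0 leaves the real vector of values
  \<open>poly (jpoly i) x\<close>, whose squared norm \<open>S\<close> is at least 1.\<close>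

lemma exists_unit_real_eigenvector:
  assumes "complex_of_real x \<in> spectrum J"
  obtains v where "unit_real_eigenvector J x v" "Re (v $ 0) > 0"
proof -
  from assms obtain u where u: "eigenvector J u (complex_of_real x)"
    by (auto simp: spectrum_def eigenvalue_def)
  have uc: "u \<in> carrier_vec M" and u0: "u $ 0 \<noteq> 0"
    using u eigenvector_first_nonzero[OF u] by (auto simp: eigenvector_def)
  define S where "S = (\<Sum>i<M. (poly (jpoly i) x)\<^sup>2)"
  have "(poly (jpoly 0) x)\<^sup>2 \<le> S"
    unfolding S_def by (rule member_le_sum) (use M_pos in auto)
  then have S: "S > 0" by simp
  define v where "v = (1 / (u $ 0 * complex_of_real (sqrt S))) \<cdot>\<^sub>v u"
  have vi: "v $ i = complex_of_real (poly (jpoly i) x / sqrt S)" if "i < M" for i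
    using eigenvector_jpoly[OF u that] u0 uc that by (simp add: v_def)
  have vc: "v \<in> carrier_vec M" using uc by (simp add: v_def)
  have v0: "v $ 0 = complex_of_real (1 / sqrt S)" using vi[OF M_pos] by simp
  have "v \<noteq> 0\<^sub>v M" using v0 S M_pos by auto
  moreover have "J *\<^sub>v v = complex_of_real x \<cdot>\<^sub>v v"
    using u uc by (simp add: v_def eigenvector_def mult_mat_vec[of J M M] smult_smult_assoc mult.commute)
  ultimately have "eigenvector J v (complex_of_real x)"
    using vc by (auto simp: eigenvector_def)
  moreover have "v \<bullet>c v = 1"
  proof -
    have "v \<bullet>c v = (\<Sum>i<M. v $ i * cnj (v $ i))"
      using vc by (auto simp: scalar_prod_def atLeast0LessThan intro!: sum.cong)
    also have "\<dots> = (\<Sum>i<M. complex_of_real ((poly (jpoly i) x)\<^sup>2 / S))"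
    proof (intro sum.cong refl)
      fix i assume "i \<in> {..<M}"
      then have "v $ i * cnj (v $ i) = complex_of_real (poly (jpoly i) x / sqrt S * (poly (jpoly i) x / sqrt S))"
        by (simp only: vi lessThan_iff complex_cnj_complex_of_real of_real_mult)
      also have "poly (jpoly i) x / sqrt S * (poly (jpoly i) x / sqrt S) = (poly (jpoly i) x)\<^sup>2 / S"
        using S by (simp add: power2_eq_square)
      finally show "v $ i * cnj (v $ i) = complex_of_real ((poly (jpoly i) x)\<^sup>2 / S)" .
    qed
    also have "\<dots> = complex_of_real (S / S)"
      by (simp only: S_def of_real_sum sum_divide_distrib)
    finally show ?thesis using S by simp
  qed
  ultimately have "unit_real_eigenvector J x v"
    using vi vc by (auto simp: unit_real_eigenvector_def)
  moreover have "Re (v $ 0) > 0" using v0 S by simp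
  ultimately show ?thesis by (rule that)
qed

lemma sgn_lead_coeff_jpoly:
  assumes "i + 1 < M"
  shows "sgn (lead_coeff (jpoly (i + 1))) = sgn (lead_coeff (jpoly i)) * sgn (Re (J $$ (i, i + 1)))"
proof -
  have "lead_coeff (jpoly (i + 1)) = lead_coeff (jpoly i) / jc i (i + 1)"
    using jpoly_degree[of i] assms by simp
  moreover have "sgn (a / b) = sgn a * sgn b" for a b :: real
    by (cases "0::real" a rule: linorder_cases; cases "0::real" b rule: linorder_cases)
      (auto simp: divide_pos_pos divide_neg_pos divide_pos_neg divide_neg_neg)
  ultimately show ?thesis by (simp only: jc_def)
qed

text \<open>Guarantees that the systems \<open>(v, p)\<close> of the theorem exist. As
  \<open>jpoly 0 = 1\<close>, compatibility asks the eigenvectors for a positive entry 0.\<close>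

lemma exists_compatible_system:
  assumes \<mu>: "\<And>k. k < M \<Longrightarrow> complex_of_real (\<mu> k) \<in> spectrum J" and inj: "inj_on \<mu> {..<M}"
  obtains v where "\<And>k. k < M \<Longrightarrow> unit_real_eigenvector J (\<mu> k) (v k)"
    "orthonormal_polys M \<mu> (spectral_weight v) jpoly" "compatible_signs M J v jpoly"
proof -
  have "\<exists>v. k < M \<longrightarrow> unit_real_eigenvector J (\<mu> k) v \<and> Re (v $ 0) > 0" for k
    using exists_unit_real_eigenvector[OF \<mu>[of k]] by metis
  then obtain v where v: "unit_real_eigenvector J (\<mu> k) (v k)" "Re (v k $ 0) > 0" if "k < M" for k
    by metis
  have "compatible_signs M J v jpoly"
    unfolding compatible_signs_def using sgn_lead_coeff_jpoly v(2) by simp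
  then show ?thesis using that v jpoly_orthonormal[OF v(1) inj] by blast
qed

text \<open>Both \<open>p\<close> and \<open>jpoly\<close> obey the same recursion for the signs of
  leading coefficients, so on the nodes they differ by the global sign \<open>s\<close> of
  \<open>p 0\<close>. The same \<open>s\<close> relates \<open>sqrt (spectral_weight v k)\<close>,
  the absolute value of entry 0, to that entry itself, and \<open>s * s = 1\<close>.\<close>

lemma eigenvector_eq_orthonormal_polys:
  assumes v: "\<And>k. k < M \<Longrightarrow> unit_real_eigenvector J (\<mu> k) (v k)" and inj: "inj_on \<mu> {..<M}"
    and p: "orthonormal_polys M \<mu> (spectral_weight v) p" and sg: "compatible_signs M J v p"
    and ik: "i < M" "k < M"
  shows "v k $ i = complex_of_real (sqrt (spectral_weight v k) * poly (p i) (\<mu> k))"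
proof -
  note vk = unit_real_eigenvectorD[OF v[OF ik(2)]]
  define s where "s = sgn (lead_coeff (p 0))"
  have w: "spectral_weight v l > 0" if "l < M" for l
  proof -
    note vl = unit_real_eigenvectorD[OF v[OF that]]
    have "Re (v l $ 0) \<noteq> 0" using eigenvector_first_nonzero[OF vl(1)] vl(3)[OF M_pos] by auto
    then show ?thesis by (simp add: spectral_weight_def)
  qed
  have nz: "lead_coeff (p i) \<noteq> 0" "lead_coeff (p 0) \<noteq> 0"
    using orthonormal_polys_nonzero[OF p] ik M_pos by auto
  have "sgn (lead_coeff (p i)) * sgn (lead_coeff (jpoly i)) = s" using ik(1)
  proof (induction i)
    case (Suc i)
    let ?b = "sgn (Re (J $$ (i, i + 1)))"
    have b: "?b * ?b = 1" using jc_off[of i] Suc by (simp add: jc_def sgn_if)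
    have "sgn (lead_coeff (p (i + 1))) * sgn (lead_coeff (jpoly (i + 1))) =
        (sgn (lead_coeff (p i)) * ?b) * (sgn (lead_coeff (jpoly i)) * ?b)"
      using sg Suc.prems sgn_lead_coeff_jpoly[of i] by (simp add: compatible_signs_def)
    also have "\<dots> = (sgn (lead_coeff (p i)) * sgn (lead_coeff (jpoly i))) * (?b * ?b)"
      by (simp only: mult_ac)
    also have "\<dots> = s" unfolding b using Suc by simp
    finally show ?case by simp
  qed (simp add: s_def)
  then have pi: "poly (p i) (\<mu> k) = s * poly (jpoly i) (\<mu> k)"
    using orthonormal_polys_unique[OF p jpoly_orthonormal[OF v inj] w ik] by simp
  have s: "s = sgn (Re (v k $ 0))" "s * s = 1"
    using sg ik nz by (auto simp: compatible_signs_def s_def sgn_if)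
  have "sqrt (spectral_weight v k) = s * Re (v k $ 0)"
    unfolding s(1) spectral_weight_def by (simp add: sgn_mult_self_eq mult_sgn_abs abs_sgn mult.commute)
  then have "sqrt (spectral_weight v k) * poly (p i) (\<mu> k) = (s * s) * (Re (v k $ 0) * poly (jpoly i) (\<mu> k))"
    unfolding pi by (simp only: mult_ac)
  then have "sqrt (spectral_weight v k) * poly (p i) (\<mu> k) = Re (v k $ 0) * poly (jpoly i) (\<mu> k)"
    unfolding s(2) by simp
  moreover have "v k $ i = complex_of_real (Re (v k $ 0) * poly (jpoly i) (\<mu> k))"
    using eigenvector_jpoly[OF vk(1) ik(1)] vk(3)[OF M_pos] by simp
  ultimately show ?thesis by simp
qed

lemma unitary_diag_op_transform:
  assumes v: "\<And>k. k < M \<Longrightarrow> unit_real_eigenvector J (\<mu> k) (v k)" and inj: "inj_on \<mu> {..<M}"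
    and p: "orthonormal_polys M \<mu> (spectral_weight v) p" and sg: "compatible_signs M J v p"
  shows "unitary_diag M J (op_transform M \<mu> (spectral_weight v) p) \<mu>"
proof -
  have "mat M M (\<lambda>(i, k). v k $ i) = op_transform M \<mu> (spectral_weight v) p"
    unfolding op_transform_def
    using eigenvector_eq_orthonormal_polys[OF assms] by (intro cong_mat) auto
  then show ?thesis using eigenvector_matrix[OF v inj] by simp
qed

end

section \<open>Gram matrices and the pencil\<close>

text \<open>Complex counterpart of \<open>real_lincomb\<close>: diagonalizing the pencil may produce
  complex coefficients.\<close>

definition lincomb :: "nat \<Rightarrow> nat \<Rightarrow> (nat \<Rightarrow> complex) \<Rightarrow> (nat \<Rightarrow> complex mat) \<Rightarrow> complex mat" where
  "lincomb M n c B = mat M M (\<lambda>(r, s). \<Sum>j<n. c j * B j $$ (r, s))"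

definition frob :: "nat \<Rightarrow> complex mat \<Rightarrow> complex mat \<Rightarrow> complex" where
  "frob M X Y = (\<Sum>r<M. \<Sum>s<M. cnj (X $$ (r, s)) * Y $$ (r, s))"

lemma lincomb_carrier [simp]: "lincomb M n c B \<in> carrier_mat M M"
  by (simp add: lincomb_def)

lemma lincomb_index [simp]:
  "r < M \<Longrightarrow> s < M \<Longrightarrow> lincomb M n c B $$ (r, s) = (\<Sum>j<n. c j * B j $$ (r, s))"
  by (simp add: lincomb_def)

lemma real_lincomb_eq:
  "real_lincomb M c Bs = lincomb M (length Bs) (\<lambda>j. complex_of_real (c $ j)) ((!) Bs)"
  by (simp add: real_lincomb_def lincomb_def)

lemma mat_trace_adjoint_mult:
  assumes "X \<in> carrier_mat M M" "Y \<in> carrier_mat M M"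
  shows "mat_trace (mat_adjoint X * Y) = frob M X Y"
proof -
  have "mat_trace (mat_adjoint X * Y) = (\<Sum>s<M. (mat_adjoint X * Y) $$ (s, s))"
    using assms by (simp add: mat_trace_def del: index_mult_mat(1))
  also have "\<dots> = (\<Sum>s<M. \<Sum>r<M. cnj (X $$ (r, s)) * Y $$ (r, s))"
  proof (intro sum.cong refl)
    fix s assume "s \<in> {..<M}"
    then have s: "s < M" by simp
    have "(mat_adjoint X * Y) $$ (s, s) = (\<Sum>r<M. mat_adjoint X $$ (s, r) * Y $$ (r, s))"
      by (rule mat_mult_index[OF mat_adjoint_carrier[OF assms(1)] assms(2) s s])
    then show "(mat_adjoint X * Y) $$ (s, s) = (\<Sum>r<M. cnj (X $$ (r, s)) * Y $$ (r, s))"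
      using assms s by simp
  qed
  also have "\<dots> = frob M X Y" unfolding frob_def by (rule sum.swap)
  finally show ?thesis .
qed

lemma mat_trace_commute:
  assumes "X \<in> carrier_mat n n" "Y \<in> carrier_mat n n"
  shows "mat_trace (X * Y) = mat_trace (Y * X)"
proof -
  have "mat_trace (X * Y) = (\<Sum>i<n. \<Sum>l<n. X $$ (i, l) * Y $$ (l, i))"
    "mat_trace (Y * X) = (\<Sum>i<n. \<Sum>l<n. Y $$ (i, l) * X $$ (l, i))"
    using assms by (auto simp: mat_trace_def mat_mult_index[of _ n n _ n] simp del: index_mult_mat(1)
        intro!: sum.cong)
  moreover have "(\<Sum>i<n. \<Sum>l<n. X $$ (i, l) * Y $$ (l, i)) = (\<Sum>l<n. \<Sum>i<n. X $$ (i, l) * Y $$ (l, i))"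
    by (rule sum.swap)
  ultimately show ?thesis by (simp only: mult.commute)
qed

lemma mat_trace_minus:
  assumes "X \<in> carrier_mat n n" "Y \<in> carrier_mat n n"
  shows "mat_trace (X - Y) = mat_trace X - mat_trace Y"
  using assms by (simp add: mat_trace_def sum_subtractf)

lemma frob_self: "frob M X X = complex_of_real (\<Sum>r<M. \<Sum>s<M. (cmod (X $$ (r, s)))\<^sup>2)"
  by (simp add: frob_def complex_norm_square mult.commute del: of_real_power)

lemma frob_self_ge_0: "Re (frob M X X) \<ge> 0"
  unfolding frob_self by (simp only: Re_complex_of_real) (intro sum_nonneg, simp)

lemma frob_self_eq_0:
  assumes "X \<in> carrier_mat M M" "frob M X X = 0"
  shows "X = 0\<^sub>m M M"
proof -
  have "(\<Sum>r<M. \<Sum>s<M. (cmod (X $$ (r, s)))\<^sup>2) = 0"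
    using assms(2) unfolding frob_self by (simp only: of_real_eq_0_iff)
  then have "X $$ (r, s) = 0" if "r < M" "s < M" for r s
    using that by (auto simp: sum_nonneg_eq_0_iff sum_nonneg)
  then show ?thesis using assms(1) by (intro eq_matI) auto
qed

lemma frob_zero_right: "frob M X (0\<^sub>m M M) = 0"
  by (simp add: frob_def)

lemma frob_commute: "frob M X Y = cnj (frob M Y X)"
  by (simp add: frob_def mult.commute)

lemma frob_lincomb_right:
  "frob M X (lincomb M n c B) = (\<Sum>j<n. c j * frob M X (B j))"
proof -
  have "frob M X (lincomb M n c B) = (\<Sum>r<M. \<Sum>s<M. \<Sum>j<n. c j * (cnj (X $$ (r, s)) * B j $$ (r, s)))"
    by (simp add: frob_def sum_distrib_left mult.left_commute)
  also have "\<dots> = (\<Sum>r<M. \<Sum>j<n. \<Sum>s<M. c j * (cnj (X $$ (r, s)) * B j $$ (r, s)))"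
    by (intro sum.cong refl sum.swap)
  also have "\<dots> = (\<Sum>j<n. \<Sum>r<M. \<Sum>s<M. c j * (cnj (X $$ (r, s)) * B j $$ (r, s)))"
    by (rule sum.swap)
  finally show ?thesis by (simp add: frob_def sum_distrib_left)
qed

lemma frob_lincomb_left:
  "frob M (lincomb M n c B) X = (\<Sum>j<n. cnj (c j) * frob M (B j) X)"
  by (subst frob_commute) (simp add: frob_lincomb_right frob_commute[of M X])

section \<open>Commutators in the trace inner product\<close>

lemma commutator_carrier [simp]:
  "X \<in> carrier_mat n n \<Longrightarrow> Y \<in> carrier_mat n n \<Longrightarrow> commutator X Y \<in> carrier_mat n n"
  unfolding commutator_def by (intro minus_carrier_mat mult_carrier_mat)

lemma commutator_eq_0_iff:
  assumes "X \<in> carrier_mat n n" "Y \<in> carrier_mat n n"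
  shows "commutator X Y = 0\<^sub>m n n \<longleftrightarrow> X * Y = Y * X"
proof
  assume *: "commutator X Y = 0\<^sub>m n n"
  show "X * Y = Y * X"
  proof (rule eq_matI)
    fix i j assume "i < dim_row (Y * X)" "j < dim_col (Y * X)"
    then have "i < n" "j < n" using assms by auto
    then show "(X * Y) $$ (i, j) = (Y * X) $$ (i, j)"
      using arg_cong[OF *, of "\<lambda>Z. Z $$ (i, j)"] assms
      by (simp add: commutator_def del: index_mult_mat(1))
  qed (use assms in auto)
qed (use assms in \<open>auto simp: commutator_def\<close>)

lemma commutator_lincomb:
  assumes R: "R \<in> carrier_mat M M" and B: "\<And>j. j < n \<Longrightarrow> B j \<in> carrier_mat M M"
  shows "commutator R (lincomb M n c B) = lincomb M n c (\<lambda>j. commutator R (B j))"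
proof (rule eq_matI)
  fix i s assume "i < dim_row (lincomb M n c (\<lambda>j. commutator R (B j)))"
    "s < dim_col (lincomb M n c (\<lambda>j. commutator R (B j)))"
  then have ij: "i < M" "s < M" by (auto simp: lincomb_def)
  have "(R * lincomb M n c B) $$ (i, s) = (\<Sum>l<M. \<Sum>j<n. c j * (R $$ (i, l) * B j $$ (l, s)))"
    unfolding mat_mult_index[OF R lincomb_carrier ij]
    using ij by (intro sum.cong refl) (simp add: sum_distrib_left mult.left_commute)
  also have "\<dots> = (\<Sum>j<n. \<Sum>l<M. c j * (R $$ (i, l) * B j $$ (l, s)))" by (rule sum.swap)
  also have "\<dots> = (\<Sum>j<n. c j * (R * B j) $$ (i, s))"
    using mat_mult_index[OF R B ij] by (intro sum.cong refl) (simp add: sum_distrib_left del: index_mult_mat(1))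
  finally have 1: "(R * lincomb M n c B) $$ (i, s) = (\<Sum>j<n. c j * (R * B j) $$ (i, s))" .
  have "(lincomb M n c B * R) $$ (i, s) = (\<Sum>l<M. \<Sum>j<n. c j * (B j $$ (i, l) * R $$ (l, s)))"
    unfolding mat_mult_index[OF lincomb_carrier R ij]
    using ij by (intro sum.cong refl) (simp add: sum_distrib_right mult.assoc)
  also have "\<dots> = (\<Sum>j<n. \<Sum>l<M. c j * (B j $$ (i, l) * R $$ (l, s)))" by (rule sum.swap)
  also have "\<dots> = (\<Sum>j<n. c j * (B j * R) $$ (i, s))"
    using mat_mult_index[OF B R ij] by (intro sum.cong refl) (simp add: sum_distrib_left del: index_mult_mat(1))
  finally have 2: "(lincomb M n c B * R) $$ (i, s) = (\<Sum>j<n. c j * (B j * R) $$ (i, s))" .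
  have "commutator R (lincomb M n c B) $$ (i, s) =
      (R * lincomb M n c B) $$ (i, s) - (lincomb M n c B * R) $$ (i, s)"
    unfolding commutator_def using R ij by (intro index_minus_mat) (auto simp: lincomb_def)
  moreover have "commutator R (B j) $$ (i, s) = (R * B j) $$ (i, s) - (B j * R) $$ (i, s)" if "j < n" for j
    unfolding commutator_def using R ij B[OF that] by (intro index_minus_mat) auto
  ultimately show "commutator R (lincomb M n c B) $$ (i, s) =
      lincomb M n c (\<lambda>j. commutator R (B j)) $$ (i, s)"
    using ij by (simp add: 1 2 right_diff_distrib sum_subtractf)
qed (use R in \<open>auto simp: lincomb_def commutator_def\<close>)

text \<open>Cyclicity of the trace and \<open>R^H = R\<close> make the commutator with
  \<open>R\<close> self-adjoint: \<open>Tr (B^H [R, C]) = Tr ([R, B]^H C)\<close>, used with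
  \<open>C = [R, A]\<close>.\<close>

lemma frob_ad2:
  assumes R: "R \<in> carrier_mat M M" "mat_adjoint R = R"
    and A: "A \<in> carrier_mat M M" and B: "B \<in> carrier_mat M M"
  shows "frob M B (ad2 R A) = frob M (commutator R B) (commutator R A)"
proof -
  note [simp] = mult_carrier_mat[of _ M M]
  define C where "C = commutator R A"
  define D where "D = mat_adjoint B"
  have C: "C \<in> carrier_mat M M" using R A by (simp add: C_def)
  have D: "D \<in> carrier_mat M M" using B by (simp add: D_def)
  have "frob M B (ad2 R A) = mat_trace (D * (R * C - C * R))"
  proof -
    have "R * C - C * R \<in> carrier_mat M M" using R(1) C by (intro minus_carrier_mat) auto
    moreover have "ad2 R A = R * C - C * R"
      by (simp only: ad2_def C_def commutator_def[of R "commutator R A"])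
    ultimately show ?thesis using mat_trace_adjoint_mult[OF B] by (simp add: D_def)
  qed
  also have "D * (R * C - C * R) = D * (R * C) - D * (C * R)"
    using C D R(1) by (intro mult_minus_distrib_mat[of _ M M _ M]) auto
  also have "mat_trace \<dots> = mat_trace (D * (R * C)) - mat_trace (D * (C * R))"
    using C D R(1) by (intro mat_trace_minus[of _ M]) auto
  also have "mat_trace (D * (C * R)) = mat_trace (R * (D * C))"
    using C D R(1) mat_trace_commute[of "D * C" M R] by (simp add: assoc_mult_mat[of D M M C M R M])
  also have "mat_trace (D * (R * C)) - mat_trace (R * (D * C)) = mat_trace (D * (R * C) - R * (D * C))"
    using C D R(1) by (intro mat_trace_minus[of _ M, symmetric]) auto
  also have "D * (R * C) - R * (D * C) = (D * R - R * D) * C"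
    using C D R(1) by (simp add: minus_mult_distrib_mat[of _ M M _ _ M] assoc_mult_mat[of _ M M _ M _ M])
  also have "D * R - R * D = mat_adjoint (commutator R B)"
  proof -
    have "mat_adjoint (R * B) = D * R" "mat_adjoint (B * R) = R * D"
      using mat_adjoint_mult[OF R(1) B] mat_adjoint_mult[OF B R(1)] R(2) by (simp_all add: D_def)
    moreover have "mat_adjoint (X - Y) = mat_adjoint X - mat_adjoint Y"
      if "X \<in> carrier_mat M M" "Y \<in> carrier_mat M M" for X Y :: "complex mat"
      using that by (intro eq_matI) auto
    ultimately show ?thesis using R(1) B by (simp add: commutator_def)
  qed
  also have "mat_trace (mat_adjoint (commutator R B) * C) = frob M (commutator R B) (commutator R A)"
    unfolding C_def using R A B by (intro mat_trace_adjoint_mult) auto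
  finally show ?thesis .
qed

text \<open>Whitening: rescaling the eigenvectors of \<open>G\<close> by
  \<open>1 / sqrt (g k)\<close> gives \<open>T\<close> with \<open>T^H G T = 1\<close>. A unitary
  \<open>U\<close> diagonalizing \<open>T^H K T\<close> preserves this identity, so
  \<open>X = T U\<close> serves both.\<close>

lemma simultaneous_diagonalization:
  fixes G K :: "complex mat"
  assumes G: "G \<in> carrier_mat n n" "mat_adjoint G = G" and K: "K \<in> carrier_mat n n" "mat_adjoint K = K"
    and pos: "\<And>x. x \<in> carrier_vec n \<Longrightarrow> x \<noteq> 0\<^sub>v n \<Longrightarrow> Re (\<Sum>i<n. cnj (x $ i) * (G *\<^sub>v x) $ i) > 0"
  obtains X l where "X \<in> carrier_mat n n" "mat_adjoint X * G * X = 1\<^sub>m n"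
    "mat_adjoint X * K * X = mat_diag n (\<lambda>k. complex_of_real (l k))"
proof -
  note mc [simp] = mult_carrier_mat[of _ n n]
  note assoc = assoc_mult_mat[of _ n n _ n _ n]
  obtain W g where Wg: "unitary_diag n G W g" using hermitian_unitary_diag[OF G] by blast
  then have W: "unitary_mat n W" by (auto simp: unitary_diag_def)
  note W' = unitary_matD[OF W]
  have g: "g k > 0" if k: "k < n" for k
  proof -
    note ev = unitary_diag_col[OF Wg k]
    then have "Re (\<Sum>i<n. cnj (col W k $ i) * (G *\<^sub>v col W k) $ i) > 0"
      using G by (intro pos) (auto simp: eigenvector_def)
    also have "(\<Sum>i<n. cnj (col W k $ i) * (G *\<^sub>v col W k) $ i) =
        (\<Sum>i<n. complex_of_real (g k) * (cnj (W $$ (i, k)) * W $$ (i, k)))"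
    proof (intro sum.cong refl)
      fix i assume "i \<in> {..<n}"
      moreover have "G *\<^sub>v col W k = complex_of_real (g k) \<cdot>\<^sub>v col W k"
        using ev by (simp add: eigenvector_def)
      ultimately show "cnj (col W k $ i) * (G *\<^sub>v col W k) $ i =
          complex_of_real (g k) * (cnj (W $$ (i, k)) * W $$ (i, k))"
        using W' k by simp
    qed
    also have "\<dots> = complex_of_real (g k) * (\<Sum>i<n. cnj (W $$ (i, k)) * W $$ (i, k))"
      by (simp only: sum_distrib_left)
    also have "(\<Sum>i<n. cnj (W $$ (i, k)) * W $$ (i, k)) = 1"
      using W unitary_mat_index_iff[OF W'(1)] k by auto
    finally show ?thesis by simp
  qed
  define S where "S = mat_diag n (\<lambda>k. complex_of_real (1 / sqrt (g k)))"
  define T where "T = W * S"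
  have S: "S \<in> carrier_mat n n" by (simp add: S_def)
  have T: "T \<in> carrier_mat n n" using W' S by (simp add: T_def)
  have Ta: "mat_adjoint T = S * mat_adjoint W"
    using W' S mat_adjoint_mult[OF W'(1) S] by (simp add: T_def) (simp add: S_def)
  let ?D = "\<lambda>d. mat_diag n (\<lambda>k. complex_of_real (d k))"
  have GW: "G * W = W * ?D g" using Wg unitary_diag_iff[OF W G(1)] by simp
  have "mat_adjoint T * G * T = S * mat_adjoint W * G * (W * S)"
    unfolding Ta by (simp only: T_def)
  also have "\<dots> = S * (mat_adjoint W * ((G * W) * S))"
    using W' S G by (simp add: assoc)
  also have "\<dots> = S * (?D g * S)"
    unfolding GW using W' S by (simp add: assoc cancel_left_mat[OF W'(2,1,3), where m=n])
  also have "\<dots> = 1\<^sub>m n"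
  proof -
    have "complex_of_real (1 / sqrt (g i)) * (complex_of_real (g i) * complex_of_real (1 / sqrt (g i))) = 1"
      if "i < n" for i
    proof -
      have "1 / sqrt (g i) * (g i * (1 / sqrt (g i))) = 1"
        using g[OF that] by (simp add: field_simps)
      then show ?thesis by (metis of_real_1 of_real_mult)
    qed
    then show ?thesis unfolding S_def mat_diag_diag by (intro eq_matI) (simp_all del: of_real_divide)
  qed
  finally have TG: "mat_adjoint T * G * T = 1\<^sub>m n" .
  define L where "L = mat_adjoint T * K * T"
  have L: "L \<in> carrier_mat n n" using T K by (simp add: L_def)
  have "mat_adjoint L = L"
    using T K by (simp add: L_def mat_adjoint_mult[of _ n n _ n] assoc)
  then obtain U l where Ul: "unitary_diag n L U l" using hermitian_unitary_diag[OF L] by blast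
  then have U: "unitary_mat n U" by (auto simp: unitary_diag_def)
  note U' = unitary_matD[OF U]
  have LU: "L * U = U * ?D l" using Ul unitary_diag_iff[OF U L] by simp
  have conj: "mat_adjoint (T * U) * Q * (T * U) = mat_adjoint U * ((mat_adjoint T * Q * T) * U)"
    if "Q \<in> carrier_mat n n" for Q
    using T U' that by (simp add: mat_adjoint_mult[of _ n n _ n] assoc)
  have "mat_adjoint (T * U) * G * (T * U) = 1\<^sub>m n"
    unfolding conj[OF G(1)] TG using U' by simp
  moreover have "mat_adjoint (T * U) * K * (T * U) = ?D l"
    unfolding conj[OF K(1)] L_def[symmetric] LU using U' by (simp add: cancel_left_mat[OF U'(2,1,3), where m=n])
  ultimately show ?thesis using that[of "T * U" l] T U' by simp
qed

section \<open>The pencil as a pair of Gram matrices\<close>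

lemma pencil_M_index:
  assumes R: "R \<in> carrier_mat M M" "mat_adjoint R = R" and B: "set Bs \<subseteq> carrier_mat M M"
    and ij: "i < length Bs" "j < length Bs"
  shows "pencil_M R Bs $$ (i, j) = frob M (commutator R (Bs ! i)) (commutator R (Bs ! j))"
proof -
  have Bi: "Bs ! i \<in> carrier_mat M M" and Bj: "Bs ! j \<in> carrier_mat M M" using B ij by auto
  have "ad2 R (Bs ! j) \<in> carrier_mat M M" unfolding ad2_def by (intro commutator_carrier R(1) Bj)
  from mat_trace_adjoint_mult[OF Bi this] show ?thesis
    using ij frob_ad2[OF R Bj Bi] by (simp add: pencil_M_def)
qed

lemma pencil_G_index:
  assumes B: "set Bs \<subseteq> carrier_mat M M" and ij: "i < length Bs" "j < length Bs"
  shows "pencil_G Bs $$ (i, j) = frob M (Bs ! i) (Bs ! j)"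
proof -
  have Bi: "Bs ! i \<in> carrier_mat M M" and Bj: "Bs ! j \<in> carrier_mat M M" using B ij by auto
  from mat_trace_adjoint_mult[OF Bi Bj] show ?thesis using ij by (simp add: pencil_G_def)
qed

text \<open>By sesquilinearity a congruence of a Gram matrix is a change of the underlying family.
  This turns the matrix identities of the simultaneous diagonalization into orthogonality relations
  between matrices.\<close>

lemma gram_congruence_index:
  assumes X: "X \<in> carrier_mat n n" and Q: "Q \<in> carrier_mat n n"
    and QC: "\<And>i j. i < n \<Longrightarrow> j < n \<Longrightarrow> Q $$ (i, j) = frob M (C i) (C j)" and ij: "i < n" "j < n"
  shows "(mat_adjoint X * Q * X) $$ (i, j) =
    frob M (lincomb M n (\<lambda>k. X $$ (k, i)) C) (lincomb M n (\<lambda>k. X $$ (k, j)) C)"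
proof -
  have Xa: "mat_adjoint X \<in> carrier_mat n n" using X by simp
  have "(mat_adjoint X * Q) $$ (i, l) = (\<Sum>k<n. cnj (X $$ (k, i)) * frob M (C k) (C l))" if "l < n" for l
    unfolding mat_mult_index[OF Xa Q ij(1) that] using X ij that by (intro sum.cong refl) (simp add: QC)
  then show ?thesis
    using mat_mult_index[OF mult_carrier_mat[OF Xa Q] X ij]
    by (simp add: frob_lincomb_right frob_lincomb_left mult.commute del: index_mult_mat(1))
qed

lemma poly_pencil_char_poly:
  assumes "K \<in> carrier_mat n n" "G \<in> carrier_mat n n"
  shows "poly (pencil_char_poly K G) z = det (K - z \<cdot>\<^sub>m G)"
  unfolding pencil_char_poly_def
  by (rule poly_det_cong[of _ n]) (use assms in auto)

text \<open>Congruence by \<open>X\<close> multiplies \<open>det (K - z G)\<close> by the nonzero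
  constant \<open>e\<close> and yields the product of the \<open>l k - z\<close>. The comparison is
  made at every point \<open>z\<close>, which determines a complex polynomial; the sign and
  \<open>e\<close> go into \<open>a\<close>.\<close>

lemma pencil_char_poly_diag:
  assumes K: "K \<in> carrier_mat n n" and G: "G \<in> carrier_mat n n" and X: "X \<in> carrier_mat n n"
    and XG: "mat_adjoint X * G * X = 1\<^sub>m n"
    and XK: "mat_adjoint X * K * X = mat_diag n (\<lambda>k. complex_of_real (l k))"
  obtains a where "a \<noteq> 0"
    "pencil_char_poly K G = Polynomial.smult a (\<Prod>k<n. [:- complex_of_real (l k), 1:])"
proof -
  note mc [simp] = mult_carrier_mat[of _ n n]
  have Xa: "mat_adjoint X \<in> carrier_mat n n" using X by simp
  define e where "e = det (mat_adjoint X) * det X"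
  have "det (mat_adjoint X) * det G * det X = 1"
    using arg_cong[OF XG, of det] X G by (simp add: det_mult[of _ n])
  then have e: "e \<noteq> 0" by (auto simp: e_def)
  have "poly (pencil_char_poly K G) z * e = (- 1) ^ n * poly (\<Prod>k<n. [:- complex_of_real (l k), 1:]) z" for z
  proof -
    have Q: "K - z \<cdot>\<^sub>m G \<in> carrier_mat n n" using K G by auto
    have "mat_adjoint X * (K - z \<cdot>\<^sub>m G) * X = mat_adjoint X * K * X - z \<cdot>\<^sub>m (mat_adjoint X * G * X)"
    proof -
      have "mat_adjoint X * (K - z \<cdot>\<^sub>m G) = mat_adjoint X * K - z \<cdot>\<^sub>m (mat_adjoint X * G)"
        using mult_minus_distrib_mat[OF Xa K, of "z \<cdot>\<^sub>m G"] mult_smult_distrib[OF Xa G, of z] G by simp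
      moreover have "(mat_adjoint X * K - z \<cdot>\<^sub>m (mat_adjoint X * G)) * X =
          mat_adjoint X * K * X - (z \<cdot>\<^sub>m (mat_adjoint X * G)) * X"
        using Xa K G X by (intro minus_mult_distrib_mat[of _ n n]) auto
      moreover have "(z \<cdot>\<^sub>m (mat_adjoint X * G)) * X = z \<cdot>\<^sub>m (mat_adjoint X * G * X)"
        using Xa G X by (intro mult_smult_assoc_mat[of _ n n]) auto
      ultimately show ?thesis by simp
    qed
    also have "\<dots> = mat_diag n (\<lambda>k. complex_of_real (l k) - z)"
      unfolding XG XK by (intro eq_matI) auto
    finally have "det (mat_adjoint X * (K - z \<cdot>\<^sub>m G) * X) = det (mat_diag n (\<lambda>k. complex_of_real (l k) - z))"
      by simp
    also have "\<dots> = prod_list (diag_mat (mat_diag n (\<lambda>k. complex_of_real (l k) - z)))"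
      by (rule det_upper_triangular[of _ n]) auto
    also have "diag_mat (mat_diag n (\<lambda>k. complex_of_real (l k) - z)) = map (\<lambda>k. complex_of_real (l k) - z) [0..<n]"
      by (auto simp: diag_mat_def)
    also have "prod_list \<dots> = (\<Prod>k<n. complex_of_real (l k) - z)"
      by (simp add: prod.distinct_set_conv_list[symmetric] atLeast0LessThan flip: atLeast_upt)
    also have "\<dots> = (\<Prod>k<n. (- 1) * poly [:- complex_of_real (l k), 1:] z)" by simp
    also have "\<dots> = (- 1) ^ n * poly (\<Prod>k<n. [:- complex_of_real (l k), 1:]) z"
      by (simp only: prod.distrib prod_constant card_lessThan poly_prod)
    finally show ?thesis
      using Q X Xa by (simp add: poly_pencil_char_poly[OF K G] e_def det_mult[of _ n] mult_ac)
  qed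
  then have "poly (pencil_char_poly K G) z =
      poly (Polynomial.smult ((- 1) ^ n / e) (\<Prod>k<n. [:- complex_of_real (l k), 1:])) z" for z
    using e by (simp add: field_simps)
  then have "pencil_char_poly K G = Polynomial.smult ((- 1) ^ n / e) (\<Prod>k<n. [:- complex_of_real (l k), 1:])"
    by (simp flip: poly_eq_poly_eq_iff add: fun_eq_iff)
  then show ?thesis using e by (intro that[of "(- 1) ^ n / e"]) auto
qed

text \<open>The columns of \<open>X\<close> are read as coordinates of matrices \<open>C i\<close>.
  Then \<open>l i\<close> is the squared norm of \<open>[R, C i]\<close>, and zero eigenvalues can
  be counted through matrices commuting with \<open>R\<close>.\<close>

lemma pencil_diagonalization:
  assumes R: "R \<in> carrier_mat M M" "mat_adjoint R = R" and B: "set Bs \<subseteq> carrier_mat M M"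
    and indep: "\<forall>c. lincomb M (length Bs) c ((!) Bs) = 0\<^sub>m M M \<longrightarrow> (\<forall>j<length Bs. c j = 0)"
  obtains C l a where
    "\<forall>i. \<exists>c. C i = lincomb M (length Bs) c ((!) Bs)"
    "\<forall>i<length Bs. \<forall>j<length Bs. frob M (C i) (C j) = (if i = j then 1 else 0)"
    "\<forall>i<length Bs. \<forall>j<length Bs.
      frob M (commutator R (C i)) (commutator R (C j)) = (if i = j then complex_of_real (l i) else 0)"
    "\<forall>c. \<exists>y. lincomb M (length Bs) c ((!) Bs) = lincomb M (length Bs) y C"
    "a \<noteq> 0" "pencil_char_poly (pencil_M R Bs) (pencil_G Bs) =
      Polynomial.smult a (\<Prod>k<length Bs. [:- complex_of_real (l k), 1:])"
proof -
  define n where "n = length Bs"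
  let ?K = "pencil_M R Bs" and ?G = "pencil_G Bs"
  have K: "?K \<in> carrier_mat n n" and G: "?G \<in> carrier_mat n n"
    by (auto simp: pencil_M_def pencil_G_def n_def)
  have Ki: "?K $$ (i, j) = frob M (commutator R (Bs ! i)) (commutator R (Bs ! j))" if "i < n" "j < n" for i j
    using that pencil_M_index[OF R B] by (simp add: n_def)
  have Gi: "?G $$ (i, j) = frob M (Bs ! i) (Bs ! j)" if "i < n" "j < n" for i j
    using that pencil_G_index[OF B] by (simp add: n_def)
  have Kh: "mat_adjoint ?K = ?K"
  proof (rule eq_matI)
    fix i j assume "i < dim_row ?K" "j < dim_col ?K"
    then have ij: "i < n" "j < n" using K by auto
    then have "mat_adjoint ?K $$ (i, j) = cnj (?K $$ (j, i))" using K by (intro mat_adjoint_index) auto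
    then show "mat_adjoint ?K $$ (i, j) = ?K $$ (i, j)"
      using ij by (simp add: Ki frob_commute[of M "commutator R (Bs ! i)"])
  qed (use K in auto)
  have Gh: "mat_adjoint ?G = ?G"
  proof (rule eq_matI)
    fix i j assume "i < dim_row ?G" "j < dim_col ?G"
    then have ij: "i < n" "j < n" using G by auto
    then have "mat_adjoint ?G $$ (i, j) = cnj (?G $$ (j, i))" using G by (intro mat_adjoint_index) auto
    then show "mat_adjoint ?G $$ (i, j) = ?G $$ (i, j)"
      using ij by (simp add: Gi frob_commute[of M "Bs ! i"])
  qed (use G in auto)
  \<comment> \<open>The quadratic form of the Gram matrix is the squared norm of the combination
    with coefficients \<open>x\<close>, nonzero by complex independence.\<close>
  have pos: "Re (\<Sum>i<n. cnj (x $ i) * (?G *\<^sub>v x) $ i) > 0" if x: "x \<in> carrier_vec n" "x \<noteq> 0\<^sub>v n" for x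
  proof -
    let ?L = "lincomb M n (($) x) ((!) Bs)"
    have "(\<Sum>i<n. cnj (x $ i) * (?G *\<^sub>v x) $ i) = frob M ?L ?L"
      unfolding frob_lincomb_left[of _ _ _ _ ?L]
      unfolding frob_lincomb_right
    proof (intro sum.cong refl)
      fix i assume "i \<in> {..<n}"
      then have i: "i < n" by simp
      show "cnj (x $ i) * (?G *\<^sub>v x) $ i = cnj (x $ i) * (\<Sum>j<n. x $ j * frob M (Bs ! i) (Bs ! j))"
        unfolding mat_mult_vec_index[OF G x(1) i] using i by (simp add: Gi mult.commute)
    qed
    moreover have "frob M ?L ?L \<noteq> 0"
    proof
      assume "frob M ?L ?L = 0"
      then have "?L = 0\<^sub>m M M" by (intro frob_self_eq_0) simp
      then have "x $ j = 0" if "j < n" for j using indep[rule_format, of "($) x" j] that by (simp add: n_def)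
      then show False using x by (auto intro!: eq_vecI)
    qed
    moreover have "Im (frob M ?L ?L) = 0" unfolding frob_self by (rule Im_complex_of_real)
    ultimately show ?thesis
      using frob_self_ge_0[of M ?L] by (auto simp: complex_eq_iff order_less_le)
  qed
  obtain X l where X: "X \<in> carrier_mat n n" and XG: "mat_adjoint X * ?G * X = 1\<^sub>m n"
    and XK: "mat_adjoint X * ?K * X = mat_diag n (\<lambda>k. complex_of_real (l k))"
    using simultaneous_diagonalization[OF G Gh K Kh pos] by blast
  obtain a where a: "a \<noteq> 0"
    "pencil_char_poly ?K ?G = Polynomial.smult a (\<Prod>k<n. [:- complex_of_real (l k), 1:])"
    using pencil_char_poly_diag[OF K G X XG XK] .
  define C where "C i = lincomb M n (\<lambda>k. X $$ (k, i)) ((!) Bs)" for i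
  have RC: "commutator R (C i) = lincomb M n (\<lambda>k. X $$ (k, i)) (\<lambda>j. commutator R (Bs ! j))" for i
    unfolding C_def using B by (intro commutator_lincomb R) (auto simp: n_def)
  show ?thesis
  proof (rule that[of C l a]; (intro allI impI)?)
    show "\<exists>c. C i = lincomb M (length Bs) c ((!) Bs)" for i by (auto simp: C_def n_def)
    show "frob M (C i) (C j) = (if i = j then 1 else 0)" if "i < length Bs" "j < length Bs" for i j
      using gram_congruence_index[OF X G Gi, of i j] that by (cases "i = j") (simp_all add: XG C_def n_def)
    show "frob M (commutator R (C i)) (commutator R (C j)) = (if i = j then complex_of_real (l i) else 0)"
      if "i < length Bs" "j < length Bs" for i j
      using gram_congruence_index[OF X K Ki, of i j] that by (cases "i = j") (simp_all add: XK RC n_def)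
    show "\<exists>y. lincomb M (length Bs) c ((!) Bs) = lincomb M (length Bs) y C" for c
    proof -
      \<comment> \<open>\<open>X^H G X = 1\<close> makes \<open>Y\<close> the inverse of
        \<open>X\<close>, so \<open>Y\<close> converts coordinates in \<open>Bs\<close> into
        coordinates in \<open>C\<close>.\<close>
      define Y where "Y = mat_adjoint X * ?G"
      have Y: "Y \<in> carrier_mat n n" using X G by (auto simp: Y_def)
      have XY: "X * Y = 1\<^sub>m n" by (rule mat_mult_left_right_inverse[OF Y X]) (simp add: Y_def XG)
      define y where "y = (\<lambda>i. \<Sum>k<n. Y $$ (i, k) * c k)"
      have cy: "c j = (\<Sum>i<n. X $$ (j, i) * y i)" if "j < n" for j
      proof -
        have "(\<Sum>i<n. X $$ (j, i) * y i) = (\<Sum>i<n. \<Sum>k<n. X $$ (j, i) * Y $$ (i, k) * c k)"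
          by (simp add: y_def sum_distrib_left mult.assoc)
        also have "\<dots> = (\<Sum>k<n. \<Sum>i<n. X $$ (j, i) * Y $$ (i, k) * c k)" by (rule sum.swap)
        also have "\<dots> = (\<Sum>k<n. (X * Y) $$ (j, k) * c k)"
          using mat_mult_index[OF X Y that]
          by (intro sum.cong refl) (simp add: sum_distrib_right del: index_mult_mat(1))
        also have "\<dots> = (\<Sum>k<n. if k = j then c k else 0)"
          unfolding XY using that by (intro sum.cong refl) auto
        also have "\<dots> = c j" using that by simp
        finally show ?thesis by simp
      qed
      have "lincomb M n c ((!) Bs) = lincomb M n y C"
      proof (rule eq_matI)
        fix r s assume "r < dim_row (lincomb M n y C)" "s < dim_col (lincomb M n y C)"
        then have rs: "r < M" "s < M" by (auto simp: lincomb_def)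
        have "lincomb M n c ((!) Bs) $$ (r, s) = (\<Sum>j<n. \<Sum>i<n. X $$ (j, i) * y i * (Bs ! j) $$ (r, s))"
          using rs by (simp add: cy sum_distrib_right)
        also have "\<dots> = (\<Sum>i<n. \<Sum>j<n. X $$ (j, i) * y i * (Bs ! j) $$ (r, s))" by (rule sum.swap)
        also have "\<dots> = lincomb M n y C $$ (r, s)"
          using rs by (simp add: C_def sum_distrib_left mult_ac)
        finally show "lincomb M n c ((!) Bs) $$ (r, s) = lincomb M n y C $$ (r, s)" .
      qed (auto simp: lincomb_def)
      then show ?thesis by (auto simp: n_def)
    qed
  qed (use a in \<open>auto simp: n_def\<close>)
qed

text \<open>The cross product of the two rows is a solution; if it vanishes, the rows are parallel
  and a solution is read off one of them. It provides the dependency among three matrices in the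
  span of \<open>J\<close> and the identity.\<close>

lemma two_equations_three_unknowns:
  fixes a1 a2 a3 b1 b2 b3 :: "'a :: idom"
  shows "\<exists>t1 t2 t3. (t1 \<noteq> 0 \<or> t2 \<noteq> 0 \<or> t3 \<noteq> 0) \<and>
    t1 * a1 + t2 * a2 + t3 * a3 = 0 \<and> t1 * b1 + t2 * b2 + t3 * b3 = 0"
proof (cases "a2 * b3 - a3 * b2 = 0 \<and> a3 * b1 - a1 * b3 = 0 \<and> a1 * b2 - a2 * b1 = 0")
  case False
  then show ?thesis
    by (intro exI[of _ "a2 * b3 - a3 * b2"] exI[of _ "a3 * b1 - a1 * b3"] exI[of _ "a1 * b2 - a2 * b1"])
      (auto simp: algebra_simps)
next
  case True
  then have cross: "a2 * b3 = a3 * b2" "a3 * b1 = a1 * b3" "a1 * b2 = a2 * b1" by auto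
  consider "a1 \<noteq> 0 \<or> a2 \<noteq> 0" | "b1 \<noteq> 0 \<or> b2 \<noteq> 0" | "a1 = 0" "b1 = 0" by auto
  then show ?thesis
  proof cases
    case 1
    then show ?thesis using cross
      by (intro exI[of _ a2] exI[of _ "- a1"] exI[of _ 0]) (auto simp: algebra_simps)
  next
    case 2
    then show ?thesis using cross
      by (intro exI[of _ b2] exI[of _ "- b1"] exI[of _ 0]) (auto simp: algebra_simps)
  next
    case 3
    then show ?thesis by (intro exI[of _ 1] exI[of _ 0]) auto
  qed
qed

lemma sorted_two_zeros:
  fixes ls :: "real list"
  assumes "sorted ls" "\<And>x. x \<in> set ls \<Longrightarrow> x \<ge> 0" "length (filter (\<lambda>x. x = 0) ls) = 2" "length ls \<ge> 3"
  shows "ls ! 0 = 0 \<and> ls ! 1 = 0 \<and> 0 < ls ! 2"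
proof -
  obtain a b c t where ls: "ls = a # b # c # t"
    using assms(4) by (auto simp: numeral_3_eq_3 Suc_le_length_iff)
  show ?thesis
  proof (cases "c = 0")
    case True
    then have "a = 0" "b = 0" using assms(1,2) by (auto simp: ls intro: antisym)
    then show ?thesis using assms(3) True by (simp add: ls)
  next
    case False
    then have c: "c > 0" using assms(2) by (simp add: ls order_less_le)
    then have "filter (\<lambda>x. x = 0) t = []"
      using assms(1) by (auto simp: ls filter_empty_conv)
    then show ?thesis using assms(3) c False by (auto simp: ls split: if_splits)
  qed
qed

section \<open>The tridiagonal matrices\<close>

text \<open>Coordinates of the tridiagonal matrices: first the diagonal, then the superdiagonal.\<close>

definition band_index :: "nat \<Rightarrow> nat \<Rightarrow> nat \<Rightarrow> nat" where
  "band_index M r s = (if r = s then r else M + min r s)"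

definition band_unit :: "nat \<Rightarrow> nat \<Rightarrow> complex mat" where
  "band_unit M j = mat M M (\<lambda>(r, s). if (r = s \<or> r + 1 = s \<or> s + 1 = r) \<and> j = band_index M r s then 1 else 0)"

lemma real_lincomb_band_unit:
  assumes n: "n = 2 * M - 1" and rs: "r < M" "s < M"
  shows "real_lincomb M c (map (band_unit M) [0..<n]) $$ (r, s) =
    (if r = s \<or> r + 1 = s \<or> s + 1 = r then complex_of_real (c $ band_index M r s) else 0)"
proof -
  have "real_lincomb M c (map (band_unit M) [0..<n]) $$ (r, s) =
      (\<Sum>j<n. complex_of_real (c $ j) * band_unit M j $$ (r, s))"
    using rs by (simp add: real_lincomb_def)
  also have "\<dots> = (\<Sum>j<n. if j = band_index M r s then
        (if r = s \<or> r + 1 = s \<or> s + 1 = r then complex_of_real (c $ j) else 0) else 0)"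
    by (rule sum.cong[OF refl]) (use rs in \<open>auto simp: band_unit_def\<close>)
  finally show ?thesis using rs by (auto simp: n band_index_def)
qed

text \<open>Keeps the quantification over bases in the theorem from being vacuous.\<close>

lemma exists_sym_tridiagonal_basis: "\<exists>Bs. sym_tridiagonal_basis M Bs"
proof -
  define n where "n = 2 * M - 1"
  note rl = real_lincomb_band_unit[OF n_def]
  let ?Bs = "map (band_unit M) [0..<n]"
  have T: "real_lincomb M c ?Bs \<in> sym_tridiagonal M" for c
  proof -
    have car: "real_lincomb M c ?Bs \<in> carrier_mat M M" by (simp add: real_lincomb_def)
    note dims = carrier_matD[OF car]
    have "elements_mat (real_lincomb M c ?Bs) \<subseteq> \<real>"
      unfolding elements_mat_def dims by (auto simp: rl)
    moreover have "transpose_mat (real_lincomb M c ?Bs) = real_lincomb M c ?Bs"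
      by (rule eq_matI) (auto simp: dims rl band_index_def min.commute)
    ultimately show ?thesis using car by (auto simp: sym_tridiagonal_def rl)
  qed
  have unit: "band_unit M j \<in> sym_tridiagonal M" for j
    by (auto simp: sym_tridiagonal_def band_unit_def elements_mat_def band_index_def min.commute
        intro!: eq_matI)
  have "c = 0\<^sub>v (length ?Bs)"
    if c: "c \<in> carrier_vec (length ?Bs)" and 0: "real_lincomb M c ?Bs = 0\<^sub>m M M" for c
  proof (rule eq_vecI)
    fix j assume "j < dim_vec (0\<^sub>v (length ?Bs) :: real vec)"
    then have j: "j < n" by simp
    \<comment> \<open>The position with \<open>band_index\<close> equal to \<open>j\<close>; beyond
      the diagonal, \<open>j < 2 * M - 1\<close> keeps the column \<open>j - M + 1\<close> below
      \<open>M\<close>.\<close>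
    define r s where "r = (if j < M then j else j - M)" and "s = (if j < M then j else j - M + 1)"
    have rs: "r < M" "s < M" "r = s \<or> r + 1 = s \<or> s + 1 = r" "band_index M r s = j"
      using j by (auto simp: n_def r_def s_def band_index_def)
    then show "c $ j = 0\<^sub>v (length ?Bs) $ j"
      using rl[OF rs(1,2), of c] rs(1-3) j unfolding rs(4) 0 by simp
  qed (use c in simp)
  moreover have "A \<in> real_span M ?Bs" if A: "A \<in> sym_tridiagonal M" for A
  proof -
    define c where "c = vec n (\<lambda>j. Re (if j < M then A $$ (j, j) else A $$ (j - M, j - M + 1)))"
    have Ac: "A \<in> carrier_mat M M" and At: "transpose_mat A = A" and Ar: "elements_mat A \<subseteq> \<real>"
      and A0: "\<And>i j. i < M \<Longrightarrow> j < M \<Longrightarrow> i + 1 < j \<or> j + 1 < i \<Longrightarrow> A $$ (i, j) = 0"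
      using A by (auto simp: sym_tridiagonal_def)
    have sym: "A $$ (i, j) = A $$ (j, i)" if "i < M" "j < M" for i j
      by (metis Ac At carrier_matD index_transpose_mat(1) that)
    have real: "complex_of_real (Re (A $$ (i, j))) = A $$ (i, j)" if "i < M" "j < M" for i j
      using Ar Ac that by (force simp: elements_mat_def)
    have "A = real_lincomb M c ?Bs"
    proof (rule eq_matI)
      fix r s assume "r < dim_row (real_lincomb M c ?Bs)" "s < dim_col (real_lincomb M c ?Bs)"
      then have rs: "r < M" "s < M" by (auto simp: real_lincomb_def)
      consider "r = s" | "s = r + 1" | "r = s + 1" | "r + 1 < s \<or> s + 1 < r" by linarith
      then show "A $$ (r, s) = real_lincomb M c ?Bs $$ (r, s)"
        unfolding rl[OF rs]
        using rs real[of r s] real[of s r] sym[of r s] A0[of r s]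
        by cases (auto simp: c_def n_def band_index_def min_def)
    qed (use Ac in \<open>auto simp: real_lincomb_def\<close>)
    moreover have "c \<in> carrier_vec (length ?Bs)" by (simp add: c_def)
    ultimately show ?thesis unfolding real_span_def by blast
  qed
  ultimately have "sym_tridiagonal_basis M ?Bs"
    using T unit by (auto simp: sym_tridiagonal_basis_def real_lin_indpt_def real_span_def n_def)
  then show ?thesis by blast
qed

text \<open>The basis matrices have real entries, so a complex relation splits into its real and
  imaginary parts. Positivity of the Gram matrix on complex vectors depends on this.\<close>

lemma sym_tridiagonal_basis_indpt_complex:
  assumes B: "sym_tridiagonal_basis M Bs"
    and 0: "lincomb M (length Bs) c ((!) Bs) = 0\<^sub>m M M" and j: "j < length Bs"
  shows "c j = 0"
proof -
  have Breal: "Im ((Bs ! j) $$ (r, s)) = 0" if "j < length Bs" "r < M" "s < M" for j r s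
  proof -
    have "Bs ! j \<in> sym_tridiagonal M" using B that by (auto simp: sym_tridiagonal_basis_def)
    then have "(Bs ! j) $$ (r, s) \<in> \<real>"
      using that by (force simp: sym_tridiagonal_def elements_mat_def)
    then show ?thesis by (simp add: complex_is_Real_iff)
  qed
  have sum0: "(\<Sum>j<length Bs. c j * (Bs ! j) $$ (r, s)) = 0" if "r < M" "s < M" for r s
    using arg_cong[OF 0, of "\<lambda>A. A $$ (r, s)"] that by simp
  have indep: "x = 0\<^sub>v (length Bs)" if "x \<in> carrier_vec (length Bs)"
    "\<And>r s. r < M \<Longrightarrow> s < M \<Longrightarrow> (\<Sum>j<length Bs. complex_of_real (x $ j) * (Bs ! j) $$ (r, s)) = 0" for x
  proof -
    have "real_lincomb M x Bs = 0\<^sub>m M M"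
      unfolding real_lincomb_def using that(2) by (intro eq_matI) auto
    then show ?thesis using B that(1) by (auto simp: sym_tridiagonal_basis_def real_lin_indpt_def)
  qed
  have "vec (length Bs) (\<lambda>j. Re (c j)) = 0\<^sub>v (length Bs)"
  proof (rule indep)
    fix r s assume rs: "r < M" "s < M"
    have "complex_of_real (Re (\<Sum>j<length Bs. c j * (Bs ! j) $$ (r, s))) =
        (\<Sum>j<length Bs. complex_of_real (vec (length Bs) (\<lambda>j. Re (c j)) $ j) * (Bs ! j) $$ (r, s))"
      unfolding Re_sum of_real_sum
      using Breal rs by (intro sum.cong refl) (auto simp: complex_eq_iff)
    then show "(\<Sum>j<length Bs. complex_of_real (vec (length Bs) (\<lambda>j. Re (c j)) $ j) * (Bs ! j) $$ (r, s)) = 0"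
      unfolding sum0[OF rs] by simp
  qed simp
  moreover have "vec (length Bs) (\<lambda>j. Im (c j)) = 0\<^sub>v (length Bs)"
  proof (rule indep)
    fix r s assume rs: "r < M" "s < M"
    have "complex_of_real (Im (\<Sum>j<length Bs. c j * (Bs ! j) $$ (r, s))) =
        (\<Sum>j<length Bs. complex_of_real (vec (length Bs) (\<lambda>j. Im (c j)) $ j) * (Bs ! j) $$ (r, s))"
      unfolding Im_sum of_real_sum
      using Breal rs by (intro sum.cong refl) (auto simp: complex_eq_iff)
    then show "(\<Sum>j<length Bs. complex_of_real (vec (length Bs) (\<lambda>j. Im (c j)) $ j) * (Bs ! j) $$ (r, s)) = 0"
      unfolding sum0[OF rs] by simp
  qed simp
  ultimately show ?thesis
    using j by (metis complex_eq_iff index_vec index_zero_vec(1) zero_complex.sel)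
qed

text \<open>\<open>R = f(J)\<close> is encoded by the shared eigenbasis \<open>U\<close>; in the
  application \<open>e\<close> is \<open>f\<close> composed with \<open>d\<close>.\<close>

locale jacobi_function = jacobi +
  fixes R U :: "complex mat" and d e :: "nat \<Rightarrow> real"
  assumes M_ge_2: "M \<ge> 2" and J_diag: "unitary_diag M J U d" and R_diag: "unitary_diag M R U e"
    and e_inj: "inj_on e {..<M}"
begin

abbreviation affine :: "complex \<Rightarrow> complex \<Rightarrow> complex mat" where
  "affine \<alpha> \<beta> \<equiv> \<alpha> \<cdot>\<^sub>m J + \<beta> \<cdot>\<^sub>m 1\<^sub>m M"

lemma affine_carrier: "affine \<alpha> \<beta> \<in> carrier_mat M M"
  by (intro add_carrier_mat smult_carrier_mat one_carrier_mat)

lemma affine_index: "r < M \<Longrightarrow> s < M \<Longrightarrow>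
    affine \<alpha> \<beta> $$ (r, s) = \<alpha> * J $$ (r, s) + \<beta> * (if r = s then 1 else 0)"
  by simp

lemma R_carrier [simp]: "R \<in> carrier_mat M M" by (rule unitary_diag_carrier[OF R_diag])

lemma R_hermitian: "mat_adjoint R = R" by (rule unitary_diag_hermitian[OF R_diag])

lemma J10: "J $$ (0, 1) \<noteq> 0" "J $$ (1, 0) \<noteq> 0"
  using jc_off[of 0] J_real[of 0 1] J_sym[of 0 1] M_ge_2 by auto

text \<open>Injectivity of \<open>e\<close> makes \<open>J\<close> a function of \<open>R\<close> in
  turn: equal eigenvalues of \<open>R\<close> belong to the same index and hence to equal
  eigenvalues of \<open>J\<close>.\<close>

lemma commute_R_imp_commute_J:
  assumes A: "A \<in> carrier_mat M M" and "R * A = A * R"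
  shows "J * A = A * J"
  by (rule unitary_diag_intertwine[OF R_diag R_diag A assms(2) _ J_diag J_diag])
    (use e_inj in \<open>auto dest: inj_onD\<close>)

lemma R_commutes_J: "R * J = J * R"
  by (rule unitary_diag_intertwine[OF J_diag J_diag J_carrier refl _ R_diag R_diag])
    (use unitary_diag_inj[OF J_diag] in \<open>auto dest: inj_onD\<close>)

lemma commutator_affine: "commutator R (affine \<alpha> \<beta>) = 0\<^sub>m M M"
proof -
  have "R * affine \<alpha> \<beta> = \<alpha> \<cdot>\<^sub>m (R * J) + \<beta> \<cdot>\<^sub>m R"
    by (subst mult_add_distrib_mat[of _ M M _ M])
      (auto simp: right_mult_one_mat[of _ M M] mult_smult_distrib[of _ M M _ M])
  moreover have "affine \<alpha> \<beta> * R = \<alpha> \<cdot>\<^sub>m (J * R) + \<beta> \<cdot>\<^sub>m R"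
    by (subst add_mult_distrib_mat[of _ M M _ _ M])
      (auto simp: left_mult_one_mat[of _ M M] mult_smult_assoc_mat[of _ M M _ M])
  ultimately show ?thesis
    by (subst commutator_eq_0_iff[OF R_carrier affine_carrier]) (simp add: R_commutes_J)
qed

lemma commutant_tridiagonal:
  assumes A: "A \<in> carrier_mat M M" and "commutator R A = 0\<^sub>m M M"
    and A0: "\<And>r. 2 \<le> r \<Longrightarrow> r < M \<Longrightarrow> A $$ (r, 0) = 0"
  shows "A = affine (A $$ (1, 0) / J $$ (1, 0)) (A $$ (0, 0) - A $$ (1, 0) / J $$ (1, 0) * J $$ (0, 0))"
proof -
  have "R * A = A * R" using assms by (simp add: commutator_eq_0_iff[OF R_carrier])
  then show ?thesis
    using commuting_tridiagonal[OF M_ge_2 A _ A0] commute_R_imp_commute_J[OF A] by simp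
qed

lemma real_span_one_J:
  "A \<in> real_span M [1\<^sub>m M, J] \<longleftrightarrow>
    (\<exists>\<alpha> \<beta> :: real. A = affine (complex_of_real \<alpha>) (complex_of_real \<beta>))"
proof -
  have *: "real_lincomb M c [1\<^sub>m M, J] = affine (complex_of_real (c $ 1)) (complex_of_real (c $ 0))" for c
    by (rule eq_matI) (auto simp: real_lincomb_def lessThan_Suc)
  show ?thesis
  proof
    assume "A \<in> real_span M [1\<^sub>m M, J]"
    then show "\<exists>\<alpha> \<beta> :: real. A = affine (complex_of_real \<alpha>) (complex_of_real \<beta>)"
      unfolding real_span_def * by blast
  next
    assume "\<exists>\<alpha> \<beta> :: real. A = affine (complex_of_real \<alpha>) (complex_of_real \<beta>)"
    then obtain \<alpha> \<beta> :: real where A: "A = affine (complex_of_real \<alpha>) (complex_of_real \<beta>)" by blast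
    have "A = real_lincomb M (vec 2 (\<lambda>i. if i = 0 then \<beta> else \<alpha>)) [1\<^sub>m M, J]"
      unfolding * A by simp
    moreover have "vec 2 (\<lambda>i. if i = 0 then \<beta> else \<alpha>) \<in> carrier_vec (length [1\<^sub>m M, J])" by simp
    ultimately show "A \<in> real_span M [1\<^sub>m M, J]" unfolding real_span_def by blast
  qed
qed

lemma real_lin_indpt_one_affine:
  "real_lin_indpt M [1\<^sub>m M, affine (complex_of_real \<alpha>) (complex_of_real \<beta>)] \<longleftrightarrow> \<alpha> \<noteq> 0"
proof -
  let ?L = "[1\<^sub>m M, affine (complex_of_real \<alpha>) (complex_of_real \<beta>)]"
  have *: "real_lincomb M c ?L $$ (r, s) = complex_of_real (c $ 0) * (if r = s then 1 else 0) +
      complex_of_real (c $ 1) * (complex_of_real \<alpha> * J $$ (r, s) + complex_of_real \<beta> * (if r = s then 1 else 0))"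
    if "r < M" "s < M" for c r s
    using that by (simp add: real_lincomb_def lessThan_Suc)
  show ?thesis
  proof
    assume ind: "real_lin_indpt M ?L"
    show "\<alpha> \<noteq> 0"
    proof
      assume \<alpha>: "\<alpha> = 0"
      \<comment> \<open>For \<open>\<alpha> = 0\<close> the second matrix is \<open>\<beta>\<close>
        times the identity, and these coefficients cancel it.\<close>
      let ?c = "vec 2 (\<lambda>i. if i = 0 then \<beta> else - 1)"
      have "real_lincomb M ?c ?L = 0\<^sub>m M M"
      proof (rule eq_matI)
        fix r s assume "r < dim_row (0\<^sub>m M M :: complex mat)" "s < dim_col (0\<^sub>m M M :: complex mat)"
        then show "real_lincomb M ?c ?L $$ (r, s) = 0\<^sub>m M M $$ (r, s)"
          by (subst *) (auto simp: \<alpha>)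
      qed (auto simp: real_lincomb_def)
      then have "?c = 0\<^sub>v (length ?L)" using ind unfolding real_lin_indpt_def by simp
      then have "?c $ 1 = 0" by simp
      then show False by simp
    qed
  next
    assume \<alpha>: "\<alpha> \<noteq> 0"
    show "real_lin_indpt M ?L"
      unfolding real_lin_indpt_def
    proof (intro ballI impI)
      fix c assume c: "c \<in> carrier_vec (length ?L)" and 0: "real_lincomb M c ?L = 0\<^sub>m M M"
      \<comment> \<open>Position \<open>(0, 1)\<close> sees \<open>J\<close> but not the
        identity.\<close>
      have "complex_of_real (c $ 1) * (complex_of_real \<alpha> * J $$ (0, 1)) = 0"
        using *[of 0 1 c] M_ge_2 unfolding 0 by simp
      then have c1: "c $ 1 = 0" using \<alpha> J10 by simp
      then have "c $ 0 = 0" using *[of 0 0 c] M_ge_2 unfolding 0 by simp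
      then show "c = 0\<^sub>v (length ?L)" using c c1 by (intro eq_vecI) (auto simp: less_Suc_eq)
    qed
  qed
qed

lemma affine_unitary_diag:
  assumes "unitary_diag M J V \<mu>"
  shows "unitary_diag M (affine (complex_of_real \<alpha>) (complex_of_real \<beta>)) V (\<lambda>k. \<alpha> * \<mu> k + \<beta>)"
proof -
  have V: "unitary_mat M V" using assms by (auto simp: unitary_diag_def)
  have JV: "(\<Sum>j<M. J $$ (i, j) * V $$ (j, k)) = complex_of_real (\<mu> k) * V $$ (i, k)" if "i < M" "k < M" for i k
    using assms that unitary_diag_iff_index[OF V J_carrier] by blast
  show ?thesis
  proof (subst unitary_diag_iff_index[OF V affine_carrier], intro allI impI)
    fix i k assume ik: "i < M" "k < M"
    have "(\<Sum>j<M. affine (complex_of_real \<alpha>) (complex_of_real \<beta>) $$ (i, j) * V $$ (j, k)) =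
        (\<Sum>j<M. complex_of_real \<alpha> * (J $$ (i, j) * V $$ (j, k)) +
          (if j = i then complex_of_real \<beta> * V $$ (j, k) else 0))"
      using ik by (intro sum.cong refl) (auto simp: algebra_simps)
    also have "\<dots> = complex_of_real \<alpha> * (complex_of_real (\<mu> k) * V $$ (i, k)) + complex_of_real \<beta> * V $$ (i, k)"
      using ik JV[OF ik] by (simp add: sum.distrib flip: sum_distrib_left)
    finally show "(\<Sum>j<M. affine (complex_of_real \<alpha>) (complex_of_real \<beta>) $$ (i, j) * V $$ (j, k)) =
        complex_of_real (\<alpha> * \<mu> k + \<beta>) * V $$ (i, k)"
      by (simp add: algebra_simps)
  qed
qed

lemma affine_sym_tridiagonal:
  "affine (complex_of_real \<alpha>) (complex_of_real \<beta>) \<in> sym_tridiagonal M"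
proof -
  have "transpose_mat (affine (complex_of_real \<alpha>) (complex_of_real \<beta>)) =
      affine (complex_of_real \<alpha>) (complex_of_real \<beta>)"
    by (rule eq_matI) (auto simp: J_sym)
  moreover have "elements_mat (affine (complex_of_real \<alpha>) (complex_of_real \<beta>)) \<subseteq> \<real>"
    by (auto simp: elements_mat_def J_real)
  ultimately show ?thesis using affine_carrier by (auto simp: sym_tridiagonal_def J_zero)
qed

end

section \<open>The kernel and the spectrum of the pencil\<close>

context jacobi_function
begin

text \<open>The coefficients from \<open>commutant_tridiagonal\<close> are a priori complex; they
  are real because they are formed from real entries of \<open>A\<close> and
  \<open>J\<close>.\<close>

lemma sym_tridiagonal_commutant:
  assumes A: "A \<in> sym_tridiagonal M" and comm: "commutator R A = 0\<^sub>m M M"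
  shows "A \<in> real_span M [1\<^sub>m M, J]"
proof -
  have Ac: "A \<in> carrier_mat M M" and A0: "\<And>r. 2 \<le> r \<Longrightarrow> r < M \<Longrightarrow> A $$ (r, 0) = 0"
    and Ar: "elements_mat A \<subseteq> \<real>"
    using A M_pos by (auto simp: sym_tridiagonal_def)
  have "A $$ (r, 0) \<in> \<real>" "J $$ (r, 0) \<in> \<real>" if "r < M" for r
    using Ar Ac that M_pos by (force simp: elements_mat_def, simp add: J_real)
  then have "A $$ (1, 0) / J $$ (1, 0) \<in> \<real>" "A $$ (0, 0) - A $$ (1, 0) / J $$ (1, 0) * J $$ (0, 0) \<in> \<real>"
    using M_ge_2 by (auto intro!: Reals_diff Reals_mult Reals_divide)
  then show ?thesis
    unfolding real_span_one_J using commutant_tridiagonal[OF Ac comm A0] by (metis Reals_cases)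
qed

context
  fixes Bs :: "complex mat list"
  assumes basis: "sym_tridiagonal_basis M Bs"
begin

lemma basis_carrier: "set Bs \<subseteq> carrier_mat M M"
  using basis by (auto simp: sym_tridiagonal_basis_def sym_tridiagonal_def)

lemma basis_length: "length Bs = 2 * M - 1"
  using basis by (simp add: sym_tridiagonal_basis_def)

lemma pencil_M_mult_vec:
  assumes c: "c \<in> carrier_vec (length Bs)" and i: "i < length Bs"
  shows "(pencil_M R Bs *\<^sub>v map_vec complex_of_real c) $ i =
    frob M (commutator R (Bs ! i)) (commutator R (real_lincomb M c Bs))"
proof -
  have K: "pencil_M R Bs \<in> carrier_mat (length Bs) (length Bs)" by (simp add: pencil_M_def)
  have cv: "map_vec complex_of_real c \<in> carrier_vec (length Bs)" using c by simp
  have "(pencil_M R Bs *\<^sub>v map_vec complex_of_real c) $ i =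
      (\<Sum>j<length Bs. complex_of_real (c $ j) * frob M (commutator R (Bs ! i)) (commutator R (Bs ! j)))"
    unfolding mat_mult_vec_index[OF K cv i]
    using pencil_M_index[OF R_carrier R_hermitian basis_carrier i] c
    by (intro sum.cong refl) (simp add: mult.commute)
  also have "\<dots> = frob M (commutator R (Bs ! i)) (commutator R (real_lincomb M c Bs))"
    unfolding real_lincomb_eq
    by (subst commutator_lincomb[OF R_carrier]) (use basis_carrier in \<open>auto simp: frob_lincomb_right\<close>)
  finally show ?thesis .
qed

text \<open>A kernel vector makes \<open>[R, A]\<close> orthogonal to every
  \<open>[R, Bs ! i]\<close>. As \<open>[R, A]\<close> is a combination of these, it is orthogonal
  to itself and vanishes.\<close>

lemma pencil_kernel_eq: "pencil_kernel M R Bs = real_span M [1\<^sub>m M, J]"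
proof (intro equalityI subsetI)
  fix A assume "A \<in> pencil_kernel M R Bs"
  then obtain c where c: "c \<in> carrier_vec (length Bs)" and A: "A = real_lincomb M c Bs"
    and 0: "pencil_M R Bs *\<^sub>v map_vec complex_of_real c = 0\<^sub>v (length Bs)"
    by (auto simp: pencil_kernel_def)
  have RB: "frob M (commutator R (Bs ! i)) (commutator R A) = 0" if "i < length Bs" for i
    using pencil_M_mult_vec[OF c that] that by (simp add: 0 A)
  have "commutator R A = lincomb M (length Bs) (\<lambda>j. complex_of_real (c $ j)) (\<lambda>j. commutator R (Bs ! j))"
    unfolding A real_lincomb_eq
    by (rule commutator_lincomb[OF R_carrier]) (use basis_carrier in auto)
  then have "frob M (commutator R A) (commutator R A) =
      (\<Sum>j<length Bs. complex_of_real (c $ j) * frob M (commutator R (Bs ! j)) (commutator R A))"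
    using frob_lincomb_left[of M "length Bs" "\<lambda>j. complex_of_real (c $ j)"
        "\<lambda>j. commutator R (Bs ! j)" "commutator R A"] by simp
  then have "frob M (commutator R A) (commutator R A) = 0" using RB by simp
  then have "commutator R A = 0\<^sub>m M M"
    by (intro frob_self_eq_0 commutator_carrier) (auto simp: A real_lincomb_def)
  moreover have "A \<in> sym_tridiagonal M"
  proof -
    have "A \<in> real_span M Bs" using c by (auto simp: A real_span_def)
    then show ?thesis using basis by (simp add: sym_tridiagonal_basis_def)
  qed
  ultimately show "A \<in> real_span M [1\<^sub>m M, J]" by (intro sym_tridiagonal_commutant)
next
  fix A assume "A \<in> real_span M [1\<^sub>m M, J]"
  then obtain \<alpha> \<beta> :: real where A: "A = affine (complex_of_real \<alpha>) (complex_of_real \<beta>)"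
    unfolding real_span_one_J by blast
  then have "A \<in> real_span M Bs"
    using affine_sym_tridiagonal basis by (simp add: sym_tridiagonal_basis_def)
  then obtain c where c: "c \<in> carrier_vec (length Bs)" "A = real_lincomb M c Bs"
    by (auto simp: real_span_def)
  have RA: "commutator R (real_lincomb M c Bs) = 0\<^sub>m M M"
    unfolding c(2)[symmetric] A by (rule commutator_affine)
  have "pencil_M R Bs *\<^sub>v map_vec complex_of_real c = 0\<^sub>v (length Bs)"
  proof (rule eq_vecI)
    fix i assume "i < dim_vec (0\<^sub>v (length Bs) :: complex vec)"
    then have i: "i < length Bs" by simp
    then show "(pencil_M R Bs *\<^sub>v map_vec complex_of_real c) $ i = 0\<^sub>v (length Bs) $ i"
      using pencil_M_mult_vec[OF c(1) i] by (simp only: RA frob_zero_right index_zero_vec)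
  qed (simp add: pencil_M_def)
  then show "A \<in> pencil_kernel M R Bs" using c by (auto simp: pencil_kernel_def)
qed

text \<open>Complex combinations of tridiagonal matrices still have zeros in the first column from
  row 2 on, which is all that \<open>commutant_tridiagonal\<close> asks of their shape.\<close>

lemma lincomb_commutant:
  assumes "A = lincomb M (length Bs) c ((!) Bs)" and "commutator R A = 0\<^sub>m M M"
  shows "\<exists>\<alpha> \<beta>. A = affine \<alpha> \<beta>"
proof -
  have "(Bs ! j) $$ (r, 0) = 0" if "2 \<le> r" "r < M" "j < length Bs" for r j
  proof -
    have "Bs ! j \<in> sym_tridiagonal M" using basis that by (auto simp: sym_tridiagonal_basis_def)
    then show ?thesis using that by (auto simp: sym_tridiagonal_def)
  qed
  then have "A $$ (r, 0) = 0" if "2 \<le> r" "r < M" for r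
    using that M_pos by (simp add: assms(1))
  then show ?thesis using commutant_tridiagonal[OF _ assms(2)] by (auto simp: assms(1))
qed

text \<open>\<open>l i = 0\<close> means that \<open>C i\<close> commutes with \<open>R\<close>, so
  that \<open>C i\<close> lies in the complex span of \<open>J\<close> and the identity. At least
  two such indices occur because \<open>J\<close> and the identity expand in these
  \<open>C i\<close> alone; at most two because three matrices in that span are dependent, whereas
  the \<open>C i\<close> are orthonormal.\<close>

lemma card_zero_eigenvalues:
  assumes C: "\<And>i. \<exists>c. C i = lincomb M (length Bs) c ((!) Bs)"
    and orth: "\<And>i j. i < length Bs \<Longrightarrow> j < length Bs \<Longrightarrow> frob M (C i) (C j) = (if i = j then 1 else 0)"
    and RC: "\<And>i j. i < length Bs \<Longrightarrow> j < length Bs \<Longrightarrow>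
      frob M (commutator R (C i)) (commutator R (C j)) = (if i = j then complex_of_real (l i) else 0)"
    and ex: "\<And>c. \<exists>y. lincomb M (length Bs) c ((!) Bs) = lincomb M (length Bs) y C"
  shows "card {i. i < length Bs \<and> l i = 0} = 2"
proof -
  define n where "n = length Bs"
  define Z where "Z = {i. i < n \<and> l i = 0}"
  have fin: "finite Z" by (simp add: Z_def)
  have Cc: "C i \<in> carrier_mat M M" for i using C[of i] by auto
  have RC0: "commutator R (C i) = 0\<^sub>m M M" if "i \<in> Z" for i
    using RC[of i i] that Cc[of i] by (intro frob_self_eq_0) (auto simp: Z_def n_def)
  have expand: "\<exists>y. \<forall>r<M. \<forall>s<M. affine (complex_of_real \<alpha>) (complex_of_real \<beta>) $$ (r, s) =
      (\<Sum>i\<in>Z. y i * C i $$ (r, s))" for \<alpha> \<beta> :: real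
  proof -
    let ?A = "affine (complex_of_real \<alpha>) (complex_of_real \<beta>)"
    have "?A \<in> real_span M Bs"
      using affine_sym_tridiagonal basis by (simp add: sym_tridiagonal_basis_def)
    then obtain c where "?A = lincomb M (length Bs) c ((!) Bs)"
      by (auto simp: real_span_def real_lincomb_eq)
    then obtain y where y: "?A = lincomb M n y C"
      using ex[of c] by (auto simp: n_def)
    have RA: "commutator R ?A = lincomb M n y (\<lambda>j. commutator R (C j))"
      unfolding y by (rule commutator_lincomb[OF R_carrier Cc])
    \<comment> \<open>Pairing \<open>[R, ?A] = 0\<close> with \<open>[R, C i]\<close> leaves
      \<open>y i * l i = 0\<close>, and \<open>l i\<close> is nonzero off \<open>Z\<close>.\<close>
    have "y i = 0" if i: "i < n" "i \<notin> Z" for i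
    proof -
      have "0 = frob M (commutator R (C i)) (commutator R ?A)"
        by (simp only: commutator_affine frob_zero_right)
      also have "\<dots> = (\<Sum>j<n. if j = i then y j * complex_of_real (l i) else 0)"
        unfolding RA frob_lincomb_right using RC i by (intro sum.cong refl) (auto simp: n_def)
      also have "\<dots> = y i * complex_of_real (l i)" using i by simp
      finally show ?thesis using i by (auto simp: Z_def)
    qed
    then have "?A $$ (r, s) = (\<Sum>i\<in>Z. y i * C i $$ (r, s))" if "r < M" "s < M" for r s
      unfolding y lincomb_index[OF that]
      by (intro sum.mono_neutral_right) (auto simp: Z_def)
    then show ?thesis by blast
  qed
  have "card Z \<ge> 2"
  proof (rule ccontr)
    assume "\<not> 2 \<le> card Z"
    then have "card Z \<le> Suc 0" by simp
    then obtain k where k: "Z \<subseteq> {k}"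
      using card_le_Suc0_iff_eq[OF fin] by blast
    have single: "\<exists>z. \<forall>r<M. \<forall>s<M. affine (complex_of_real \<alpha>) (complex_of_real \<beta>) $$ (r, s) = z * C k $$ (r, s)"
      for \<alpha> \<beta> :: real
    proof -
      obtain y where y: "\<forall>r<M. \<forall>s<M. affine (complex_of_real \<alpha>) (complex_of_real \<beta>) $$ (r, s) =
          (\<Sum>i\<in>Z. y i * C i $$ (r, s))" using expand by blast
      have "Z = {} \<or> Z = {k}" using k by auto
      then show ?thesis
      proof
        assume "Z = {}" then show ?thesis using y by (intro exI[of _ 0]) simp
      next
        assume "Z = {k}" then show ?thesis using y by (intro exI[of _ "y k"]) simp
      qed
    qed
    obtain z where z: "\<forall>r<M. \<forall>s<M. affine (complex_of_real 1) (complex_of_real 0) $$ (r, s) = z * C k $$ (r, s)"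
      using single by blast
    obtain z' where z': "\<forall>r<M. \<forall>s<M. affine (complex_of_real 0) (complex_of_real 1) $$ (r, s) = z' * C k $$ (r, s)"
      using single by blast
    \<comment> \<open>\<open>J\<close> and the identity would both be multiples of
      \<open>C k\<close>. Position \<open>(0, 1)\<close>, nonzero in \<open>J\<close> and zero in
      the identity, forces \<open>z' = 0\<close>, against the diagonal of the identity.\<close>
    have "J $$ (0, 1) = z * C k $$ (0, 1)" using z[rule_format, of 0 1] M_ge_2 by simp
    then have "C k $$ (0, 1) \<noteq> 0" using J10 by auto
    moreover have "0 = z' * C k $$ (0, 1)" using z'[rule_format, of 0 1] M_ge_2 by simp
    ultimately have "z' = 0" by simp
    then show False using z'[rule_format, of 0 0] M_ge_2 by simp
  qed
  moreover have "card Z \<le> 2"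
  proof (rule ccontr)
    assume "\<not> card Z \<le> 2"
    then obtain T where T: "T \<subseteq> Z" "card T = 3"
      using obtain_subset_with_card_n[of 3 Z] by auto
    then obtain i1 i2 i3 where T_eq: "T = {i1, i2, i3}" and ne: "i1 \<noteq> i2" "i1 \<noteq> i3" "i2 \<noteq> i3"
      by (auto simp: card_3_iff)
    have "\<exists>\<alpha> \<beta>. i \<in> Z \<longrightarrow> C i = affine \<alpha> \<beta>" for i
      using lincomb_commutant RC0[of i] C[of i] by blast
    then obtain \<alpha> \<beta> where \<alpha>\<beta>: "C i = affine (\<alpha> i) (\<beta> i)" if "i \<in> Z" for i by metis
    obtain t1 t2 t3 where t: "t1 \<noteq> 0 \<or> t2 \<noteq> 0 \<or> t3 \<noteq> 0"
      "t1 * \<alpha> i1 + t2 * \<alpha> i2 + t3 * \<alpha> i3 = 0" "t1 * \<beta> i1 + t2 * \<beta> i2 + t3 * \<beta> i3 = 0"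
      using two_equations_three_unknowns by blast
    define x where "x i = (if i = i1 then t1 else if i = i2 then t2 else if i = i3 then t3 else 0)" for i
    have iZ: "i1 \<in> Z" "i2 \<in> Z" "i3 \<in> Z" using T T_eq by auto
    then have in_n: "i1 < n" "i2 < n" "i3 < n" by (auto simp: Z_def)
    have "lincomb M n x C = 0\<^sub>m M M"
    proof (rule eq_matI)
      fix r s assume "r < dim_row (0\<^sub>m M M :: complex mat)" "s < dim_col (0\<^sub>m M M :: complex mat)"
      then have rs: "r < M" "s < M" by auto
      have "lincomb M n x C $$ (r, s) = (\<Sum>i\<in>{i1, i2, i3}. x i * C i $$ (r, s))"
        unfolding lincomb_index[OF rs] using in_n by (intro sum.mono_neutral_right) (auto simp: x_def)
      also have "\<dots> = t1 * affine (\<alpha> i1) (\<beta> i1) $$ (r, s) + t2 * affine (\<alpha> i2) (\<beta> i2) $$ (r, s)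
          + t3 * affine (\<alpha> i3) (\<beta> i3) $$ (r, s)"
        using ne by (simp add: \<alpha>\<beta>[OF iZ(1)] \<alpha>\<beta>[OF iZ(2)] \<alpha>\<beta>[OF iZ(3)] x_def)
      also have "\<dots> = (t1 * \<alpha> i1 + t2 * \<alpha> i2 + t3 * \<alpha> i3) * J $$ (r, s) +
          (t1 * \<beta> i1 + t2 * \<beta> i2 + t3 * \<beta> i3) * (if r = s then 1 else 0)"
        unfolding affine_index[OF rs] by (simp only: algebra_simps)
      finally show "lincomb M n x C $$ (r, s) = 0\<^sub>m M M $$ (r, s)" using rs by (simp only: t) simp
    qed (auto simp: lincomb_def)
    then have "x i = 0" if "i < n" for i
    proof -
      \<comment> \<open>Pairing with the orthonormal \<open>C i\<close> extracts the coefficient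
        \<open>x i\<close>.\<close>
      have "0 = frob M (C i) (lincomb M n x C)"
        unfolding \<open>lincomb M n x C = 0\<^sub>m M M\<close> by (simp only: frob_zero_right)
      also have "\<dots> = (\<Sum>j<n. if j = i then x j else 0)"
        unfolding frob_lincomb_right using orth that by (intro sum.cong refl) (auto simp: n_def)
      finally show ?thesis using that by simp
    qed
    then have "x i1 = 0" "x i2 = 0" "x i3 = 0" using in_n by auto
    then show False using t(1) ne by (simp add: x_def)
  qed
  ultimately show ?thesis by (simp add: Z_def n_def)
qed

text \<open>The list is \<open>l\<close> sorted. Its entries are nonnegative as squared norms of the
  \<open>[R, C i]\<close>, so the two zeros come first.\<close>

lemma pencil_eigenvalues_exist:
  "\<exists>ls. pencil_eigenvalues (pencil_M R Bs) (pencil_G Bs) ls \<and> ls ! 0 = 0 \<and> ls ! 1 = 0 \<and> 0 < ls ! 2"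
proof -
  have indep: "\<forall>c. lincomb M (length Bs) c ((!) Bs) = 0\<^sub>m M M \<longrightarrow> (\<forall>j<length Bs. c j = 0)"
    using sym_tridiagonal_basis_indpt_complex[OF basis] by blast
  obtain C l a where C: "\<forall>i. \<exists>c. C i = lincomb M (length Bs) c ((!) Bs)"
    "\<forall>i<length Bs. \<forall>j<length Bs. frob M (C i) (C j) = (if i = j then 1 else 0)"
    and RC: "\<forall>i<length Bs. \<forall>j<length Bs.
      frob M (commutator R (C i)) (commutator R (C j)) = (if i = j then complex_of_real (l i) else 0)"
    and ex: "\<forall>c. \<exists>y. lincomb M (length Bs) c ((!) Bs) = lincomb M (length Bs) y C"
    and a: "a \<noteq> 0" "pencil_char_poly (pencil_M R Bs) (pencil_G Bs) =
      Polynomial.smult a (\<Prod>k<length Bs. [:- complex_of_real (l k), 1:])"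
    using pencil_diagonalization[OF R_carrier R_hermitian basis_carrier indep] .
  define n where "n = length Bs"
  define ls where "ls = sort (map l [0..<n])"
  have mset: "mset ls = mset (map l [0..<n])" by (simp add: ls_def)
  have "l i \<ge> 0" if "i < n" for i
    using frob_self_ge_0[of M "commutator R (C i)"] RC that by (simp add: n_def)
  then have nonneg: "x \<ge> 0" if "x \<in> set ls" for x using that by (auto simp: ls_def)
  have "length (filter (\<lambda>x. x = 0) ls) = length (filter (\<lambda>x. x = 0) (map l [0..<n]))"
    by (metis mset mset_filter size_mset)
  also have "\<dots> = length (filter (\<lambda>i. l i = 0) [0..<n])"
    by (simp add: filter_map comp_def)
  also have "\<dots> = card {i. i < n \<and> l i = 0}"
    by (subst distinct_card[symmetric]) (auto intro!: arg_cong[of _ _ card])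
  also have "\<dots> = 2" unfolding n_def by (rule card_zero_eigenvalues[of C l]) (use C RC ex in blast)+
  finally have zeros: "length (filter (\<lambda>x. x = 0) ls) = 2" .
  \<comment> \<open>\<open>2 * M - 1\<close> is at least 3 because \<open>M \<ge> 2\<close>, so that
    a third eigenvalue exists.\<close>
  have "length ls \<ge> 3" using basis_length M_ge_2 by (simp add: ls_def n_def)
  from sorted_two_zeros[OF _ nonneg zeros this] have "ls ! 0 = 0 \<and> ls ! 1 = 0 \<and> 0 < ls ! 2"
    by (simp add: ls_def)
  moreover have "pencil_eigenvalues (pencil_M R Bs) (pencil_G Bs) ls"
  proof -
    have "(\<Prod>x\<leftarrow>ls. [:- complex_of_real x, 1:]) = (\<Prod>x\<leftarrow>map l [0..<n]. [:- complex_of_real x, 1:])"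
      unfolding prod_mset_prod_list[symmetric] mset_map[of "\<lambda>x. [:- complex_of_real x, 1:]"] mset ..
    also have "\<dots> = (\<Prod>k<n. [:- complex_of_real (l k), 1:])"
      by (simp add: comp_def prod.distinct_set_conv_list[symmetric] atLeast0LessThan flip: atLeast_upt)
    finally show ?thesis
      using a by (auto simp: pencil_eigenvalues_def n_def[symmetric] ls_def pencil_M_def)
  qed
  ultimately show ?thesis by blast
qed

lemma pencil_kernel_affine:
  assumes "A \<in> pencil_kernel M R Bs" "real_lin_indpt M [1\<^sub>m M, A]"
  obtains \<alpha> \<beta> :: real where "\<alpha> \<noteq> 0" "A = affine (complex_of_real \<alpha>) (complex_of_real \<beta>)"
  using assms unfolding pencil_kernel_eq real_span_one_J by (metis real_lin_indpt_one_affine)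

end

end

text \<open>The existence of a basis, of an enumeration \<open>\<mu>\<close> and of a system
  \<open>(v, p)\<close> is asserted next to the universal claims about them, so that none of these
  holds vacuously.\<close>

theorem theorem12p3:
  fixes M :: nat and J R :: "complex mat" and f :: "real \<Rightarrow> real"
  assumes "M \<ge> 2"
    and "jacobi_matrix M J"
    and "inj_on f {x. complex_of_real x \<in> spectrum J}"
    and "R = mat_fun M f J"
  shows "spectrum J \<subseteq> \<real> \<and> simple_spectrum J \<and>
    R \<in> carrier_mat M M \<and> mat_adjoint R = R \<and> simple_spectrum R \<and> commutator R J = 0\<^sub>m M M \<and>
    real_lin_indpt M [1\<^sub>m M, J] \<and>
    (\<exists>Bs. sym_tridiagonal_basis M Bs) \<and>
    (\<forall>Bs. sym_tridiagonal_basis M Bs \<longrightarrow>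
       pencil_kernel M R Bs = real_span M [1\<^sub>m M, J] \<and>
       (\<exists>ls. pencil_eigenvalues (pencil_M R Bs) (pencil_G Bs) ls \<and>
             ls ! 0 = 0 \<and> ls ! 1 = 0 \<and> 0 < ls ! 2) \<and>
       (\<forall>A\<in>pencil_kernel M R Bs. real_lin_indpt M [1\<^sub>m M, A] \<longrightarrow>
          (\<exists>\<alpha> \<beta> :: real. \<alpha> \<noteq> 0 \<and>
             A = complex_of_real \<alpha> \<cdot>\<^sub>m J + complex_of_real \<beta> \<cdot>\<^sub>m 1\<^sub>m M))) \<and>
    (\<exists>\<mu> :: nat \<Rightarrow> real. bij_betw (\<lambda>k. complex_of_real (\<mu> k)) {..<M} (spectrum J)) \<and>
    (\<forall>\<mu> :: nat \<Rightarrow> real. bij_betw (\<lambda>k. complex_of_real (\<mu> k)) {..<M} (spectrum J) \<longrightarrow>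
       (\<exists>v p. (\<forall>k<M. unit_real_eigenvector J (\<mu> k) (v k)) \<and>
              orthonormal_polys M \<mu> (spectral_weight v) p \<and> compatible_signs M J v p) \<and>
       (\<forall>v p. (\<forall>k<M. unit_real_eigenvector J (\<mu> k) (v k)) \<and>
              orthonormal_polys M \<mu> (spectral_weight v) p \<and> compatible_signs M J v p \<longrightarrow>
          (let V = op_transform M \<mu> (spectral_weight v) p in
             (\<forall>i<M. \<forall>k<M. v k $ i =
                complex_of_real (sqrt (spectral_weight v k) * poly (p i) (\<mu> k))) \<and>
             unique_orthonormal_eigenbasis M J V \<and>
             (\<forall>Bs. sym_tridiagonal_basis M Bs \<longrightarrow>
                (\<forall>A\<in>pencil_kernel M R Bs. real_lin_indpt M [1\<^sub>m M, A] \<longrightarrow>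
                   unique_orthonormal_eigenbasis M A V)) \<and>
             unique_karhunen_loeve M R V)))"
proof -
  interpret jacobi M J
    using assms by unfold_locales auto
  obtain U d where U: "unitary_diag M J U d" and d: "inj_on d {..<M}"
    by (rule spectral_decomposition)
  have spec: "spectrum J = (\<lambda>k. complex_of_real (d k)) ` {..<M}"
    by (rule unitary_diag_spectrum[OF U])
  \<comment> \<open>Valid for every diagonalization of \<open>J\<close>, so it applies to the matrix
    of the polynomial transform as well as to \<open>U\<close>.\<close>
  have R: "unitary_diag M R V (\<lambda>k. f (\<mu> k))" if "unitary_diag M J V \<mu>" for V \<mu>
    using mat_fun_unitary_diag[OF that] assms(4) by simp
  have f_inj: "inj_on (\<lambda>k. f (\<mu> k)) {..<M}" if "unitary_diag M J V \<mu>" for V \<mu>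
  proof -
    have "\<mu> ` {..<M} \<subseteq> {x. complex_of_real x \<in> spectrum J}"
      unfolding unitary_diag_spectrum[OF that] by auto
    then have "inj_on (f \<circ> \<mu>) {..<M}"
      using unitary_diag_inj[OF that] assms(3) by (intro comp_inj_on) (auto intro: inj_on_subset)
    then show ?thesis by (simp add: comp_def)
  qed
  interpret jacobi_function M J R U d "\<lambda>k. f (d k)"
    using assms(1) U R[OF U] f_inj[OF U] by unfold_locales
  have one_J: "affine (complex_of_real 1) (complex_of_real 0) = J"
    by (rule eq_matI) auto
  have main: "(\<forall>i<M. \<forall>k<M. v k $ i = complex_of_real (sqrt (spectral_weight v k) * poly (p i) (\<mu> k))) \<and>
      unique_orthonormal_eigenbasis M J V \<and>
      (\<forall>Bs. sym_tridiagonal_basis M Bs \<longrightarrow>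
         (\<forall>A\<in>pencil_kernel M R Bs. real_lin_indpt M [1\<^sub>m M, A] \<longrightarrow> unique_orthonormal_eigenbasis M A V)) \<and>
      unique_karhunen_loeve M R V"
    if bij: "bij_betw (\<lambda>k. complex_of_real (\<mu> k)) {..<M} (spectrum J)"
      and v: "\<forall>k<M. unit_real_eigenvector J (\<mu> k) (v k)"
      and p: "orthonormal_polys M \<mu> (spectral_weight v) p" "compatible_signs M J v p"
      and V: "V = op_transform M \<mu> (spectral_weight v) p" for \<mu> v p V
  proof -
    have inj: "inj_on \<mu> {..<M}" using bij by (auto simp: bij_betw_def inj_on_def)
    have JV: "unitary_diag M J V \<mu>"
      unfolding V using v by (intro unitary_diag_op_transform inj p) auto
    have "unique_orthonormal_eigenbasis M A V"
      if A: "sym_tridiagonal_basis M Bs" "A \<in> pencil_kernel M R Bs" "real_lin_indpt M [1\<^sub>m M, A]" for A Bs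
    proof -
      obtain \<alpha> \<beta> :: real where \<alpha>: "\<alpha> \<noteq> 0" and A_eq: "A = affine (complex_of_real \<alpha>) (complex_of_real \<beta>)"
        using pencil_kernel_affine[OF A] .
      have "inj_on (\<lambda>k. \<alpha> * \<mu> k + \<beta>) {..<M}" using inj \<alpha> by (auto simp: inj_on_def)
      then show ?thesis unfolding A_eq by (rule unique_eigenbasis_unitary_diag[OF affine_unitary_diag[OF JV]])
    qed
    moreover have "v k $ i = complex_of_real (sqrt (spectral_weight v k) * poly (p i) (\<mu> k))"
      if "i < M" "k < M" for i k
      using v by (intro eigenvector_eq_orthonormal_polys inj p that) auto
    ultimately show ?thesis
      using unique_eigenbasis_unitary_diag[OF JV inj]
        unique_eigenbasis_unitary_diag[OF R[OF JV] f_inj[OF JV]]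
      by (auto simp: unique_karhunen_loeve_def)
  qed
  have exist: "\<exists>v p. (\<forall>k<M. unit_real_eigenvector J (\<mu> k) (v k)) \<and>
      orthonormal_polys M \<mu> (spectral_weight v) p \<and> compatible_signs M J v p"
    if bij: "bij_betw (\<lambda>k. complex_of_real (\<mu> k)) {..<M} (spectrum J)" for \<mu>
  proof -
    have "inj_on \<mu> {..<M}" and "\<And>k. k < M \<Longrightarrow> complex_of_real (\<mu> k) \<in> spectrum J"
      using bij by (auto simp: bij_betw_def inj_on_def)
    then show ?thesis using exists_compatible_system[of \<mu>] by metis
  qed
  show ?thesis
  proof (intro conjI allI impI)
    show "spectrum J \<subseteq> \<real>" by (auto simp: spec)
    show "simple_spectrum J" by (rule unitary_diag_simple_spectrum[OF U d])
    show "R \<in> carrier_mat M M" by (rule R_carrier)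
    show "mat_adjoint R = R" by (rule R_hermitian)
    show "simple_spectrum R" by (rule unitary_diag_simple_spectrum[OF R[OF U] f_inj[OF U]])
    show "commutator R J = 0\<^sub>m M M" using commutator_affine[of 1 0] one_J by simp
    show "real_lin_indpt M [1\<^sub>m M, J]" using real_lin_indpt_one_affine[of 1 0] one_J by simp
    show "\<exists>Bs. sym_tridiagonal_basis M Bs" by (rule exists_sym_tridiagonal_basis)
    show "\<exists>\<mu> :: nat \<Rightarrow> real. bij_betw (\<lambda>k. complex_of_real (\<mu> k)) {..<M} (spectrum J)"
      using d spec by (intro exI[of _ d]) (auto simp: bij_betw_def inj_on_def)
  next
    fix Bs assume Bs: "sym_tridiagonal_basis M Bs"
    show "pencil_kernel M R Bs = real_span M [1\<^sub>m M, J]" by (rule pencil_kernel_eq[OF Bs])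
    show "\<exists>ls. pencil_eigenvalues (pencil_M R Bs) (pencil_G Bs) ls \<and> ls ! 0 = 0 \<and> ls ! 1 = 0 \<and> 0 < ls ! 2"
      by (rule pencil_eigenvalues_exist[OF Bs])
    show "\<forall>A\<in>pencil_kernel M R Bs. real_lin_indpt M [1\<^sub>m M, A] \<longrightarrow>
        (\<exists>\<alpha> \<beta> :: real. \<alpha> \<noteq> 0 \<and> A = affine (complex_of_real \<alpha>) (complex_of_real \<beta>))"
      using pencil_kernel_affine[OF Bs] by metis
  next
    fix \<mu> :: "nat \<Rightarrow> real" assume bij: "bij_betw (\<lambda>k. complex_of_real (\<mu> k)) {..<M} (spectrum J)"
    show "\<exists>v p. (\<forall>k<M. unit_real_eigenvector J (\<mu> k) (v k)) \<and>
        orthonormal_polys M \<mu> (spectral_weight v) p \<and> compatible_signs M J v p"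
      by (rule exist[OF bij])
    fix v p
    assume "(\<forall>k<M. unit_real_eigenvector J (\<mu> k) (v k)) \<and>
        orthonormal_polys M \<mu> (spectral_weight v) p \<and> compatible_signs M J v p"
    then show "let V = op_transform M \<mu> (spectral_weight v) p in
        (\<forall>i<M. \<forall>k<M. v k $ i = complex_of_real (sqrt (spectral_weight v k) * poly (p i) (\<mu> k))) \<and>
        unique_orthonormal_eigenbasis M J V \<and>
        (\<forall>Bs. sym_tridiagonal_basis M Bs \<longrightarrow>
           (\<forall>A\<in>pencil_kernel M R Bs. real_lin_indpt M [1\<^sub>m M, A] \<longrightarrow> unique_orthonormal_eigenbasis M A V)) \<and>
        unique_karhunen_loeve M R V"
      unfolding Let_def using main[OF bij _ _ _ refl, of v p] by blast
  qed
qed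

end
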